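(* Let $(X_n)_{n\ge 1}$ be the unbalanced step-reinforced random walk with parameters $p\in[0,1]$ and $\alpha\in(0,1]$ built from the i.i.d. real random variables $(\xi_n)_{n\ge1}$, let $T_n=\sum_{k=1}^n X_k$ and $a=(2p-1)\alpha$. Assume that $\mathbb E[|\xi_1|^r]<+\infty$ for some $1<r<2$, and put $\mu_1=\mathbb E[\xi_1]$. (i) If $-1\le a<1/2$, then $n^{1-\frac1r}\left(\frac{T_n}{n}-\frac{(1-\alpha)\mu_1}{1-a}\right)\to0$ almost surely as $n\to+\infty$. (ii) If $a=1/2$, then $\frac{n^{1-\frac1r}}{\sqrt{\log n}}\left(\frac{T_n}{n}-2(1-\alpha)\mu_1\right)\to0$ almost surely as $n\to+\infty$. (iii) If $1/2<a<1$, then $n^{\frac32-\frac1r-a}\left(\frac{T_n}{n}-\frac{(1-\alpha)\mu_1}{1-a}\right)\to0$ almost surely as $n\to+\infty$.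
   Context: Unbalanced step-reinforced random walk with parameters $(p,\alpha)$: let $(\xi_n)_{n\ge1}$ be i.i.d. real random variables, let $(U_n)_{n\ge1}$ be independent with $U_n$ uniform on $\{1,\dots,n\}$, let $(\gamma_n)_{n\ge1}$ be i.i.d. with $\mathbb P(\gamma_n=1)=\alpha=1-\mathbb P(\gamma_n=0)$, and let $(\rho_n)_{n\ge1}$ be i.i.d. with $\mathbb P(\rho_n=1)=p=1-\mathbb P(\rho_n=-1)$; the four sequences are mutually independent. The steps are $X_1=\xi_1$ and, for $n\ge1$, $X_{n+1}=\gamma_n\rho_nX_{U_n}+(1-\gamma_n)\xi_{n+1}$; that is, $X_{n+1}$ equals $X_{U_n}$ with probability $p\alpha$, $-X_{U_n}$ with probability $(1-p)\alpha$, and $\xi_{n+1}$ with probability $1-\alpha$. *)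

theory Defs
  imports "HOL-Probability.Probability"
begin

text \<open>
  All sequences are indexed from 1; their values at index 0 are irrelevant.
  The variables \<open>U n\<close> are uniform on \<open>{1..n}\<close> by their law, hence take values in \<open>{1..n}\<close>
  only almost surely. So \<open>X\<close> is a parameter constrained by the recursion, which determines it
  up to a null set, rather than a recursive definition that would need a guard for termination.
\<close>

locale step_reinforced_walk = prob_space M
  for M :: "'w measure"
    and \<xi> :: "nat \<Rightarrow> 'w \<Rightarrow> real"
    and U :: "nat \<Rightarrow> 'w \<Rightarrow> nat"
    and \<gamma> \<rho> :: "nat \<Rightarrow> 'w \<Rightarrow> real"
    and p \<alpha> :: real
    and X :: "nat \<Rightarrow> 'w \<Rightarrow> real" +
  assumes indep_xi: "indep_vars (\<lambda>_. borel) \<xi> {1..}"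
    and law_xi: "\<And>n. n \<ge> 1 \<Longrightarrow> distr M borel (\<xi> n) = distr M borel (\<xi> 1)"
    and indep_U: "indep_vars (\<lambda>_. count_space UNIV) U {1..}"
    and law_U: "\<And>n. n \<ge> 1 \<Longrightarrow> distr M (count_space UNIV) (U n) = measure_pmf (pmf_of_set {1..n})"
    and indep_gamma: "indep_vars (\<lambda>_. borel) \<gamma> {1..}"
    and law_gamma: "\<And>n. n \<ge> 1 \<Longrightarrow> prob {\<omega> \<in> space M. \<gamma> n \<omega> = 1} = \<alpha>"
      "\<And>n. n \<ge> 1 \<Longrightarrow> prob {\<omega> \<in> space M. \<gamma> n \<omega> = 0} = 1 - \<alpha>"
    and indep_rho: "indep_vars (\<lambda>_. borel) \<rho> {1..}"
    and law_rho: "\<And>n. n \<ge> 1 \<Longrightarrow> prob {\<omega> \<in> space M. \<rho> n \<omega> = 1} = p"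
      "\<And>n. n \<ge> 1 \<Longrightarrow> prob {\<omega> \<in> space M. \<rho> n \<omega> = - 1} = 1 - p"
    \<comment> \<open>Mutual independence of the four sequences, each viewed as one random element of the
      sequence space; \<open>U\<close> is embedded into the reals so that the four have the same type.\<close>
    and indep_sequences:
      "indep_vars (\<lambda>_. Pi\<^sub>M {1..} (\<lambda>_. borel))
         (\<lambda>i \<omega>. \<lambda>n\<in>{1..}. ([\<xi>, \<lambda>n \<omega>. real (U n \<omega>), \<gamma>, \<rho>] ! i) n \<omega>) {..<4::nat}"
    and X_first: "\<And>\<omega>. \<omega> \<in> space M \<Longrightarrow> X 1 \<omega> = \<xi> 1 \<omega>"
    and X_step: "\<And>n \<omega>. n \<ge> 1 \<Longrightarrow> \<omega> \<in> space M \<Longrightarrow>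
      X (n + 1) \<omega> = \<gamma> n \<omega> * \<rho> n \<omega> * X (U n \<omega>) \<omega> + (1 - \<gamma> n \<omega>) * \<xi> (n + 1) \<omega>"

end

theory Submission
  imports Defs "HOL-Real_Asymp.Real_Asymp"
begin

text \<open>
  Up to signs and a null set, every step is a copy of some \<open>\<xi> k\<close>, so \<open>\<bar>X n\<bar>\<close> is stochastically dominated
  by \<open>\<bar>\<xi> 1\<bar>\<close> and, by Borel--Cantelli, almost surely \<open>\<bar>X n\<bar> \<le> n\<^sup>1\<^sup>/\<^sup>r\<close> for all large \<open>n\<close>. Truncating at
  this level and centring given the past, \<open>W n = T n - c n\<close> with \<open>c = (1 - \<alpha>) \<mu>1 / (1 - a)\<close> satisfies
  \<open>W (n + 1) = (1 + a / n) W n + \<delta> (n + 1) + \<beta> (n + 1)\<close> with martingale differences \<open>\<delta>\<close>. For every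
  \<open>s \<ge> 1 / r\<close> the series of \<open>\<delta> n / n\<^sup>s\<close> converges almost surely, by Kolmogorov's maximal inequality and
  the moment assumption, while \<open>\<beta> n / n\<^sup>s = o (1 / n)\<close>. If moreover \<open>a < s\<close>, the recursion for \<open>W n / n\<^sup>s\<close>
  contracts at rate \<open>(s - a) / n\<close>, so \<open>W n / n\<^sup>s\<close> tends to 0. The choice \<open>s = 1 / r\<close> gives the first two
  cases (\<open>a \<le> 1 / 2 < 1 / r\<close>) and \<open>s = a + 1 / r - 1 / 2\<close> the third.
\<close>

subsection \<open>Linear recursions with vanishing perturbations\<close>

lemma contraction_recursion_tendsto_0:
  fixes A \<theta> R :: "nat \<Rightarrow> real"
  assumes rec: "\<forall>\<^sub>F n in sequentially. A (Suc n) = (1 - \<theta> n) * A n + \<theta> n * R n"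
    and \<theta>: "\<forall>\<^sub>F n in sequentially. 0 < \<theta> n \<and> \<theta> n \<le> 1"
    and div: "\<not> summable \<theta>"
    and R: "R \<longlonglongrightarrow> 0"
  shows "A \<longlonglongrightarrow> 0"
proof (rule LIMSEQ_I)
  fix e :: real assume "e > 0"
  define \<epsilon> where "\<epsilon> = e / 2"
  have \<epsilon>: "\<epsilon> > 0" using \<open>e > 0\<close> by (simp add: \<epsilon>_def)
  have "\<forall>\<^sub>F n in sequentially. \<bar>R n\<bar> < \<epsilon>"
    using tendstoD[OF R \<epsilon>] by (simp add: dist_real_def)
  with rec \<theta> have "\<forall>\<^sub>F n in sequentially. A (Suc n) = (1 - \<theta> n) * A n + \<theta> n * R n \<and> 0 < \<theta> n \<and> \<theta> n \<le> 1 \<and> \<bar>R n\<bar> < \<epsilon>"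
    by eventually_elim auto
  then obtain N where N: "\<And>n. n \<ge> N \<Longrightarrow> A (Suc n) = (1 - \<theta> n) * A n + \<theta> n * R n"
    "\<And>n. n \<ge> N \<Longrightarrow> 0 < \<theta> n" "\<And>n. n \<ge> N \<Longrightarrow> \<theta> n \<le> 1" "\<And>n. n \<ge> N \<Longrightarrow> \<bar>R n\<bar> < \<epsilon>"
    unfolding eventually_sequentially by blast
  define C where "C = \<bar>A N\<bar>"
  have bound: "\<bar>A (N + m)\<bar> \<le> \<epsilon> + C * exp (- (\<Sum>i<m. \<theta> (N + i)))" for m
  proof (induction m)
    case 0 then show ?case using \<epsilon> by (simp add: C_def)
  next
    case (Suc m)
    let ?t = "\<theta> (N + m)" let ?E = "exp (- (\<Sum>i<m. \<theta> (N + i)))"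
    have t: "0 < ?t" "?t \<le> 1" "\<bar>R (N + m)\<bar> < \<epsilon>" using N by auto
    have "\<bar>A (N + Suc m)\<bar> \<le> \<bar>(1 - ?t) * A (N + m)\<bar> + \<bar>?t * R (N + m)\<bar>"
      using N(1)[of "N + m"] by (simp add: abs_triangle_ineq)
    also have "\<dots> = (1 - ?t) * \<bar>A (N + m)\<bar> + ?t * \<bar>R (N + m)\<bar>"
      using t by (simp add: abs_mult)
    also have "\<dots> \<le> (1 - ?t) * (\<epsilon> + C * ?E) + ?t * \<epsilon>"
      using t Suc by (intro add_mono mult_left_mono) auto
    also have "\<dots> = \<epsilon> + C * ?E * (1 - ?t)" by (simp add: algebra_simps)
    also have "\<dots> \<le> \<epsilon> + C * ?E * exp (- ?t)"
      using exp_ge_add_one_self[of "- ?t"] by (intro add_left_mono mult_left_mono) (auto simp: C_def)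
    also have "\<dots> = \<epsilon> + C * exp (- (\<Sum>i<Suc m. \<theta> (N + i)))"
      by (simp add: exp_add[symmetric])
    finally show ?case .
  qed
  have "\<not> summable (\<lambda>i. \<theta> (N + i))"
    using div summable_iff_shift[of \<theta> N] by (simp add: add.commute)
  then have "\<not> (\<exists>B. \<forall>m. (\<Sum>i<m. \<theta> (N + i)) \<le> B)"
    using N(2) by (meson bounded_imp_summable le_add1 less_imp_le summableI_nonneg_bounded)
  then obtain m where m: "(\<Sum>i<m. \<theta> (N + i)) > ln (C / \<epsilon> + 1)" by (meson not_le)
  have "\<bar>A n\<bar> < e" if "n \<ge> N + m" for n
  proof -
    define k where "k = n - N"
    have k: "n = N + k" "k \<ge> m" using that by (auto simp: k_def)
    have "(\<Sum>i<m. \<theta> (N + i)) \<le> (\<Sum>i<k. \<theta> (N + i))"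
      using k N(2) by (intro sum_mono2) (auto intro: less_imp_le)
    with m have "exp (- (\<Sum>i<k. \<theta> (N + i))) < exp (- ln (C / \<epsilon> + 1))" by simp
    also have "\<dots> = 1 / (C / \<epsilon> + 1)"
      using \<epsilon> by (simp add: exp_minus C_def add_nonneg_pos field_simps)
    finally have "C * exp (- (\<Sum>i<k. \<theta> (N + i))) \<le> C * (1 / (C / \<epsilon> + 1))"
      by (intro mult_left_mono) (auto simp: C_def)
    also have "\<dots> < \<epsilon>"
      using \<epsilon> by (auto simp: C_def field_simps add_nonneg_pos)
    finally show ?thesis using bound[of k] k by (simp add: \<epsilon>_def)
  qed
  then show "\<exists>no. \<forall>n\<ge>no. norm (A n - 0) < e" by auto
qed

lemma relative_growth_asymp:
  fixes a s :: real
  shows "(\<lambda>n. real n * (1 - (1 + a / real n) * real n powr s * real (Suc n) powr (- s))) \<longlonglongrightarrow> s - a"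
  by real_asymp

lemma perturbed_growth_recursion_tendsto_0:
  fixes W \<delta> \<beta> :: "nat \<Rightarrow> real" and a s :: real
  assumes rec: "\<And>n. n \<ge> 1 \<Longrightarrow> W (Suc n) = W n * (1 + a / n) + \<delta> (Suc n) + \<beta> (Suc n)"
    and \<delta>: "summable (\<lambda>n. \<delta> (n + 2) * real (n + 2) powr (- s))"
    and \<beta>: "(\<lambda>n. real n powr (1 - s) * \<beta> n) \<longlonglongrightarrow> 0"
    and "a < s"
  shows "(\<lambda>n. W n * real n powr (- s)) \<longlonglongrightarrow> 0"
proof -
  define V where "V n = W n * real n powr (- s)" for n
  define d where "d n = \<delta> n * real n powr (- s)" for n
  define R where "R n = (\<Sum>k. d (k + Suc n))" for n
  define \<theta> where "\<theta> n = 1 - (1 + a / real n) * real n powr s * real (Suc n) powr (- s)" for n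
  define B where "B n = \<beta> (Suc n) * real (Suc n) powr (- s) / \<theta> n" for n
  have sd: "summable d" using \<delta> summable_iff_shift[of d 2] by (simp add: d_def)
  have R0: "R \<longlonglongrightarrow> 0"
  proof -
    have "R n = suminf d - (\<Sum>k<Suc n. d k)" for n
      unfolding R_def using suminf_split_initial_segment[OF sd, of "Suc n"] by simp
    then have "R = (\<lambda>n. suminf d - (\<Sum>k<Suc n. d k))" by (rule ext)
    moreover have "(\<lambda>n. suminf d - (\<Sum>k<Suc n. d k)) \<longlonglongrightarrow> suminf d - suminf d"
      by (intro tendsto_diff tendsto_const LIMSEQ_Suc summable_LIMSEQ sd)
    ultimately show ?thesis by argo
  qed
  have R_step: "R n = d (Suc n) + R (Suc n)" for n
    unfolding R_def using suminf_split_head[of "\<lambda>k. d (k + Suc n)"] sd summable_iff_shift[of d "Suc n"]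
    by simp
  have n\<theta>: "(\<lambda>n. real n * \<theta> n) \<longlonglongrightarrow> s - a"
    unfolding \<theta>_def by (rule relative_growth_asymp)
  have \<theta>0: "\<theta> \<longlonglongrightarrow> 0"
  proof (rule Lim_transform_eventually)
    show "(\<lambda>n. real n * \<theta> n / real n) \<longlonglongrightarrow> 0"
      by (rule real_tendsto_divide_at_top[OF n\<theta> filterlim_real_sequentially])
    show "\<forall>\<^sub>F n in sequentially. real n * \<theta> n / real n = \<theta> n"
      using eventually_gt_at_top[of 0] by eventually_elim simp
  qed
  have ev: "\<forall>\<^sub>F n in sequentially. 0 < \<theta> n \<and> \<theta> n \<le> 1"
  proof -
    have "\<forall>\<^sub>F n in sequentially. real n * \<theta> n > 0"
      using order_tendstoD(1)[OF n\<theta>, of 0] \<open>a < s\<close> by simp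
    moreover have "\<forall>\<^sub>F n in sequentially. \<theta> n < 1" using order_tendstoD(2)[OF \<theta>0, of 1] by simp
    ultimately show ?thesis by eventually_elim (auto simp: zero_less_mult_iff)
  qed
  have div: "\<not> summable \<theta>"
  proof
    assume "summable \<theta>"
    define c where "c = (s - a) / 2"
    have c: "0 < c" "c < s - a" using \<open>a < s\<close> by (auto simp: c_def)
    have "\<forall>\<^sub>F n in sequentially. real n * \<theta> n > c"
      using order_tendstoD(1)[OF n\<theta> c(2)] .
    then have "\<forall>\<^sub>F n in sequentially. norm (1 / real n) \<le> 1 / c * \<theta> n"
      using eventually_gt_at_top[of 0]
    proof eventually_elim
      case (elim n)
      have "1 / real n = 1 / c * (c / real n)" using c by simp
      also have "\<dots> \<le> 1 / c * \<theta> n"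
        using elim c by (intro mult_left_mono) (auto simp: divide_le_eq mult.commute)
      finally show ?case by simp
    qed
    from summable_comparison_test_ev[OF this summable_mult[OF \<open>summable \<theta>\<close>]]
    have "summable (\<lambda>n. inverse (real n))" by (simp add: inverse_eq_divide)
    then show False using not_summable_harmonic[where 'a = real] by simp
  qed
  have B0: "B \<longlonglongrightarrow> 0"
  proof -
    have "(\<lambda>n. (real (Suc n) powr (1 - s) * \<beta> (Suc n)) * (real n / real (Suc n)) / (real n * \<theta> n))
       \<longlonglongrightarrow> 0 * 1 / (s - a)"
    proof (intro tendsto_divide tendsto_mult n\<theta> LIMSEQ_Suc[OF \<beta>])
      show "(\<lambda>n. real n / real (Suc n)) \<longlonglongrightarrow> 1" by real_asymp
    qed (use \<open>a < s\<close> in auto)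
    moreover have "\<forall>\<^sub>F n in sequentially.
      (real (Suc n) powr (1 - s) * \<beta> (Suc n)) * (real n / real (Suc n)) / (real n * \<theta> n) = B n"
      using eventually_gt_at_top[of 0]
    proof eventually_elim
      case (elim n)
      have "real (Suc n) powr (1 - s) = real (Suc n) * real (Suc n) powr (- s)"
        by (simp add: powr_diff powr_minus field_simps)
      moreover have "(N * P * b) * (k / N) / (k * t) = b * P / t" if "N \<noteq> 0" "k \<noteq> 0" for N P b k t :: real
        using that by (cases "t = 0") (simp_all add: field_simps)
      ultimately show ?case using elim unfolding B_def by (metis gr_implies_not0 of_nat_eq_0_iff nat.distinct(1))
    qed
    ultimately show ?thesis by (simp add: tendsto_cong)
  qed
  have "(\<lambda>n. V n + R n) \<longlonglongrightarrow> 0"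
  proof (rule contraction_recursion_tendsto_0[OF _ ev div])
    show "(\<lambda>n. R n + B n) \<longlonglongrightarrow> 0" using tendsto_add[OF R0 B0] by simp
    show "\<forall>\<^sub>F n in sequentially. V (Suc n) + R (Suc n) = (1 - \<theta> n) * (V n + R n) + \<theta> n * (R n + B n)"
      using ev eventually_ge_at_top[of 1]
    proof eventually_elim
      case (elim n)
      have 1: "(1 - \<theta> n) * V n = W n * (1 + a / n) * real (Suc n) powr (- s)"
      proof -
        have "real n powr s * real n powr (- s) = 1" using elim by (simp add: powr_minus)
        moreover have "(1 - \<theta> n) * V n = W n * (1 + a / n) * real (Suc n) powr (- s) * (real n powr s * real n powr (- s))"
          by (simp add: \<theta>_def V_def mult_ac del: of_nat_Suc)
        ultimately show ?thesis by simp
      qed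
      have 2: "\<theta> n * B n = \<beta> (Suc n) * real (Suc n) powr (- s)" using elim by (simp add: B_def)
      have "V (Suc n) = (1 - \<theta> n) * V n + d (Suc n) + \<theta> n * B n"
        unfolding 1 2 using rec[of n] elim by (simp add: V_def d_def distrib_right del: of_nat_Suc)
      then show ?case using R_step[of n] by (simp add: algebra_simps)
    qed
  qed
  from tendsto_diff[OF this R0] show ?thesis by (simp add: V_def)
qed

subsection \<open>Almost sure convergence of square integrable martingales\<close>

locale L2_martingale_differences = prob_space M
  for M :: "'a measure" and F :: "nat \<Rightarrow> 'a measure" and d :: "nat \<Rightarrow> 'a \<Rightarrow> real" +
  assumes subalg: "\<And>n. subalgebra M (F n)"
    and mono: "\<And>m n. m \<le> n \<Longrightarrow> sets (F m) \<subseteq> sets (F n)"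
    and adapted: "\<And>n. d n \<in> borel_measurable (F (Suc n))"
    and square_integrable: "\<And>n. integrable M (\<lambda>x. (d n x)\<^sup>2)"
    and centred: "\<And>n. AE x in M. real_cond_exp M (F n) (d n) x = 0"
begin

lemma space_F: "space (F n) = space M"
  using subalg[of n] by (simp add: subalgebra_def)

lemma subalgebra_mono: "m \<le> n \<Longrightarrow> subalgebra (F n) (F m)"
  using mono space_F by (simp add: subalgebra_def)

lemma shift: "L2_martingale_differences M (\<lambda>n. F (n + m)) (\<lambda>n. d (n + m))"
  by unfold_locales (use subalg mono adapted square_integrable centred in auto)

lemma measurable_d [measurable]: "d n \<in> borel_measurable M"
  using adapted subalg measurable_from_subalg by blast

definition S :: "nat \<Rightarrow> 'a \<Rightarrow> real" where "S n x = (\<Sum>i<n. d i x)"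

lemma S_adapted: "S n \<in> borel_measurable (F n)"
  unfolding S_def
proof (intro borel_measurable_sum)
  fix i assume "i \<in> {..<n}"
  then show "d i \<in> borel_measurable (F n)"
    using measurable_from_subalg[OF subalgebra_mono[of "Suc i" n] adapted[of i]] by auto
qed

lemma measurable_S [measurable]: "S n \<in> borel_measurable M"
  using S_adapted subalg measurable_from_subalg by blast

lemma integrable_prod_of_squares:
  fixes f g :: "'a \<Rightarrow> real"
  assumes [measurable]: "f \<in> borel_measurable M" "g \<in> borel_measurable M"
    and "integrable M (\<lambda>x. (f x)\<^sup>2)" "integrable M (\<lambda>x. (g x)\<^sup>2)"
  shows "integrable M (\<lambda>x. f x * g x)"
proof (rule Bochner_Integration.integrable_bound)
  show "integrable M (\<lambda>x. (f x)\<^sup>2 + (g x)\<^sup>2)" using assms by simp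
  show "AE x in M. norm (f x * g x) \<le> norm ((f x)\<^sup>2 + (g x)\<^sup>2)"
  proof (rule AE_I2)
    fix x
    have "2 * \<bar>f x\<bar> * \<bar>g x\<bar> \<le> \<bar>f x\<bar>\<^sup>2 + \<bar>g x\<bar>\<^sup>2" by (rule sum_squares_bound)
    moreover have "0 \<le> \<bar>f x\<bar> * \<bar>g x\<bar>" by simp
    moreover have "norm (f x * g x) = \<bar>f x\<bar> * \<bar>g x\<bar>" by (simp add: abs_mult)
    moreover have "norm ((f x)\<^sup>2 + (g x)\<^sup>2) = \<bar>f x\<bar>\<^sup>2 + \<bar>g x\<bar>\<^sup>2" by simp
    ultimately show "norm (f x * g x) \<le> norm ((f x)\<^sup>2 + (g x)\<^sup>2)" by linarith
  qed
qed simp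

lemma orthogonal:
  assumes f: "f \<in> borel_measurable (F n)" and f2: "integrable M (\<lambda>x. (f x)\<^sup>2)"
  shows "(\<integral>x. f x * d n x \<partial>M) = 0"
proof -
  interpret G: finite_measure_subalgebra M "F n" by unfold_locales (rule subalg)
  interpret G: sigma_finite_subalgebra M "F n"
    by (rule finite_measure_subalgebra_is_sigma_finite) unfold_locales
  have fM: "f \<in> borel_measurable M" using f subalg measurable_from_subalg by blast
  have "(\<integral>x. f x * d n x \<partial>M) = (\<integral>x. f x * real_cond_exp M (F n) (d n) x \<partial>M)"
    by (rule G.real_cond_exp_intg(2)[symmetric])
      (use f fM f2 square_integrable in \<open>auto intro: integrable_prod_of_squares\<close>)
  also have "\<dots> = (\<integral>x. 0 \<partial>M)"
    by (rule integral_cong_AE) (use fM centred[of n] in auto)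
  finally show ?thesis by simp
qed

lemma S_square_integrable: "integrable M (\<lambda>x. (S n x)\<^sup>2)"
proof (induction n)
  case 0 then show ?case by (simp add: S_def)
next
  case (Suc n)
  have "(\<lambda>x. (S (Suc n) x)\<^sup>2) = (\<lambda>x. (S n x)\<^sup>2 + 2 * (S n x * d n x) + (d n x)\<^sup>2)"
    by (auto simp: S_def power2_eq_square algebra_simps)
  then show ?case using Suc square_integrable integrable_prod_of_squares by simp
qed

lemma integral_S_square_Suc:
  assumes A: "A \<in> sets (F n)"
  shows "(\<integral>x. indicator A x * (S (Suc n) x)\<^sup>2 \<partial>M) =
    (\<integral>x. indicator A x * (S n x)\<^sup>2 \<partial>M) + (\<integral>x. indicator A x * (d n x)\<^sup>2 \<partial>M)"
proof -
  have AM [measurable]: "A \<in> sets M" using A subalg by (auto simp: subalgebra_def)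
  note S_adapted[of n, measurable]
  have AF [measurable]: "A \<in> sets (F n)" by (rule A)
  have m: "(\<lambda>x. indicator A x * S n x) \<in> borel_measurable (F n)" by simp
  have sq: "integrable M (\<lambda>x. (indicator A x * S n x)\<^sup>2)"
  proof -
    have "(indicator A x * S n x)\<^sup>2 = indicator A x * (S n x)\<^sup>2" for x by (simp add: indicator_def)
    then show ?thesis using integrable_mult_indicator[OF AM S_square_integrable[of n]] by simp
  qed
  have "(\<lambda>x. indicator A x * (S (Suc n) x)\<^sup>2) = (\<lambda>x. indicator A x * (S n x)\<^sup>2 +
      2 * ((indicator A x * S n x) * d n x) + indicator A x * (d n x)\<^sup>2)"
    by (auto simp: S_def power2_eq_square algebra_simps)
  moreover have "integrable M (\<lambda>x. (indicator A x * S n x) * d n x)"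
    using sq square_integrable m by (intro integrable_prod_of_squares) auto
  moreover have "integrable M (\<lambda>x. indicator A x * (S n x)\<^sup>2)" "integrable M (\<lambda>x. indicator A x * (d n x)\<^sup>2)"
    using integrable_mult_indicator[OF AM S_square_integrable] integrable_mult_indicator[OF AM square_integrable]
    by simp_all
  ultimately show ?thesis using orthogonal[OF m sq] by simp
qed

lemma integral_S_square_mono:
  assumes A: "A \<in> sets (F m)" and "m \<le> n"
  shows "(\<integral>x. indicator A x * (S m x)\<^sup>2 \<partial>M) \<le> (\<integral>x. indicator A x * (S n x)\<^sup>2 \<partial>M)"
  using \<open>m \<le> n\<close>
proof (induction n rule: dec_induct)
  case (step n)
  have "A \<in> sets (F n)" using A mono step by blast
  moreover have "0 \<le> (\<integral>x. indicator A x * (d n x)\<^sup>2 \<partial>M)" by (rule integral_nonneg_AE) simp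
  ultimately show ?case using integral_S_square_Suc[of A n] step.IH by linarith
qed simp

lemma integral_S_square: "(\<integral>x. (S n x)\<^sup>2 \<partial>M) = (\<Sum>i<n. \<integral>x. (d i x)\<^sup>2 \<partial>M)"
proof (induction n)
  case (Suc n)
  have i: "(\<integral>x. indicator (space M) x * f x \<partial>M) = (\<integral>x. f x \<partial>M)" for f :: "'a \<Rightarrow> real"
    by (intro Bochner_Integration.integral_cong) auto
  have "space M \<in> sets (F n)" using space_F[of n] sets.top[of "F n"] by simp
  from integral_S_square_Suc[OF this] Suc show ?case by (simp add: i)
qed (simp add: S_def)

lemma Kolmogorov_maximal_inequality:
  assumes "\<epsilon> > 0"
  shows "prob {x \<in> space M. \<exists>k\<le>n. \<bar>S k x\<bar> \<ge> \<epsilon>} \<le> (\<Sum>i<n. \<integral>x. (d i x)\<^sup>2 \<partial>M) / \<epsilon>\<^sup>2"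
proof -
  define A where "A k = {x \<in> space M. \<bar>S k x\<bar> \<ge> \<epsilon> \<and> (\<forall>j<k. \<bar>S j x\<bar> < \<epsilon>)}" for k
  have AF: "A k \<in> sets (F k)" for k
  proof -
    have "A k = {x \<in> space (F k). \<bar>S k x\<bar> \<ge> \<epsilon>} \<inter> {x \<in> space (F k). \<forall>j\<in>{..<k}. \<bar>S j x\<bar> < \<epsilon>}"
      by (auto simp: A_def space_F)
    also have "\<dots> \<in> sets (F k)"
    proof (intro sets.Int sets.sets_Collect_finite_All)
      fix j assume "j \<in> {..<k}"
      then have [measurable]: "S j \<in> borel_measurable (F k)"
        using measurable_from_subalg[OF subalgebra_mono S_adapted, of j k] by simp
      show "{x \<in> space (F k). \<bar>S j x\<bar> < \<epsilon>} \<in> sets (F k)" by measurable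
    next
      have [measurable]: "S k \<in> borel_measurable (F k)" by (rule S_adapted)
      show "{x \<in> space (F k). \<bar>S k x\<bar> \<ge> \<epsilon>} \<in> sets (F k)" by measurable
    qed simp
    finally show ?thesis .
  qed
  then have AM [measurable]: "A k \<in> sets M" for k using subalg by (auto simp: subalgebra_def)
  have disj: "disjoint_family_on A {..n}"
    unfolding disjoint_family_on_def A_def by (auto simp: neq_iff)
  have U: "{x \<in> space M. \<exists>k\<le>n. \<bar>S k x\<bar> \<ge> \<epsilon>} = (\<Union>k\<le>n. A k)"
  proof (intro equalityI subsetI)
    fix x assume "x \<in> {x \<in> space M. \<exists>k\<le>n. \<bar>S k x\<bar> \<ge> \<epsilon>}"
    then obtain k where k: "x \<in> space M" "k \<le> n" "\<bar>S k x\<bar> \<ge> \<epsilon>" by auto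
    define l where "l = (LEAST k. \<bar>S k x\<bar> \<ge> \<epsilon>)"
    have "\<bar>S l x\<bar> \<ge> \<epsilon>" unfolding l_def using k(3) by (rule LeastI)
    moreover have "l \<le> k" unfolding l_def using k(3) by (rule Least_le)
    moreover have "\<forall>j<l. \<bar>S j x\<bar> < \<epsilon>" unfolding l_def using not_less_Least not_le by blast
    ultimately show "x \<in> (\<Union>k\<le>n. A k)" using k by (auto simp: A_def)
  qed (auto simp: A_def)
  have int: "integrable M (\<lambda>x. indicator (A k) x * (S m x)\<^sup>2)" for k m
    using integrable_mult_indicator[OF AM S_square_integrable] by simp
  have A_bound: "\<epsilon>\<^sup>2 * prob (A k) \<le> (\<integral>x. indicator (A k) x * (S n x)\<^sup>2 \<partial>M)" if "k \<le> n" for k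
  proof -
    have "\<epsilon>\<^sup>2 * prob (A k) = (\<integral>x. \<epsilon>\<^sup>2 * indicator (A k) x \<partial>M)" by simp
    also have "\<dots> \<le> (\<integral>x. indicator (A k) x * (S k x)\<^sup>2 \<partial>M)"
    proof (rule integral_mono[OF _ int])
      fix x
      show "\<epsilon>\<^sup>2 * indicator (A k) x \<le> indicator (A k) x * (S k x)\<^sup>2"
        using \<open>\<epsilon> > 0\<close> power_mono[of \<epsilon> "\<bar>S k x\<bar>" 2] by (auto simp: A_def indicator_def)
    qed (simp add: less_top[symmetric])
    also have "\<dots> \<le> (\<integral>x. indicator (A k) x * (S n x)\<^sup>2 \<partial>M)"
      by (rule integral_S_square_mono[OF AF that])
    finally show ?thesis .
  qed
  have "\<epsilon>\<^sup>2 * prob (\<Union>k\<le>n. A k) = (\<Sum>k\<le>n. \<epsilon>\<^sup>2 * prob (A k))"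
    using disj by (subst finite_measure_finite_Union) (auto simp: sum_distrib_left)
  also have "\<dots> \<le> (\<Sum>k\<le>n. \<integral>x. indicator (A k) x * (S n x)\<^sup>2 \<partial>M)"
    by (intro sum_mono A_bound) auto
  also have "\<dots> = (\<integral>x. (\<Sum>k\<le>n. indicator (A k) x * (S n x)\<^sup>2) \<partial>M)"
    by (rule Bochner_Integration.integral_sum[symmetric]) (rule int)
  also have "\<dots> \<le> (\<integral>x. (S n x)\<^sup>2 \<partial>M)"
  proof (rule integral_mono)
    show "integrable M (\<lambda>x. \<Sum>k\<le>n. indicator (A k) x * (S n x)\<^sup>2)"
      by (rule Bochner_Integration.integrable_sum) (rule int)
    fix x
    have "(\<Sum>k\<le>n. indicator (A k) x) = (indicator (\<Union>k\<le>n. A k) x :: real)"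
      using disj by (simp add: indicator_UN_disjoint)
    then have "(\<Sum>k\<le>n. indicator (A k) x * (S n x)\<^sup>2) = indicator (\<Union>k\<le>n. A k) x * (S n x)\<^sup>2"
      by (metis sum_distrib_right)
    also have "\<dots> \<le> (S n x)\<^sup>2" by (simp add: indicator_def)
    finally show "(\<Sum>k\<le>n. indicator (A k) x * (S n x)\<^sup>2) \<le> (S n x)\<^sup>2" .
  qed (rule S_square_integrable)
  finally show ?thesis unfolding U integral_S_square using \<open>\<epsilon> > 0\<close> by (simp add: field_simps)
qed

lemma Kolmogorov_maximal_inequality_infinite:
  assumes "\<epsilon> > 0" and sum: "summable (\<lambda>i. \<integral>x. (d i x)\<^sup>2 \<partial>M)"
  shows "prob {x \<in> space M. \<exists>k. \<bar>S k x\<bar> \<ge> \<epsilon>} \<le> (\<Sum>i. \<integral>x. (d i x)\<^sup>2 \<partial>M) / \<epsilon>\<^sup>2"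
proof -
  define B where "B n = {x \<in> space M. \<exists>k\<le>n. \<bar>S k x\<bar> \<ge> \<epsilon>}" for n
  have "(\<lambda>n. prob (B n)) \<longlonglongrightarrow> prob (\<Union>n. B n)"
  proof (rule finite_Lim_measure_incseq)
    show "range B \<subseteq> events" unfolding B_def by auto
    show "incseq B" unfolding incseq_def B_def by (auto intro: order_trans)
  qed
  moreover have "(\<Union>n. B n) = {x \<in> space M. \<exists>k. \<bar>S k x\<bar> \<ge> \<epsilon>}" by (auto simp: B_def)
  moreover have "prob (B n) \<le> (\<Sum>i. \<integral>x. (d i x)\<^sup>2 \<partial>M) / \<epsilon>\<^sup>2" for n
  proof -
    have "(\<Sum>i<n. \<integral>x. (d i x)\<^sup>2 \<partial>M) \<le> (\<Sum>i. \<integral>x. (d i x)\<^sup>2 \<partial>M)"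
      by (rule sum_le_suminf[OF sum]) (auto intro: integral_nonneg_AE)
    then show ?thesis
      using Kolmogorov_maximal_inequality[OF \<open>\<epsilon> > 0\<close>, of n] \<open>\<epsilon> > 0\<close>
      unfolding B_def by (meson divide_right_mono order_trans zero_le_power2)
  qed
  ultimately show ?thesis by (auto intro: LIMSEQ_le_const2)
qed

end

theorem (in L2_martingale_differences) AE_summable:
  assumes sum: "summable (\<lambda>i. \<integral>x. (d i x)\<^sup>2 \<partial>M)"
  shows "AE x in M. summable (\<lambda>i. d i x)"
proof -
  define v where "v i = (\<integral>x. (d i x)\<^sup>2 \<partial>M)" for i
  define B where "B \<epsilon> m = {x \<in> space M. \<exists>k. \<bar>\<Sum>i<k. d (i + m) x\<bar> \<ge> \<epsilon>}" for \<epsilon> m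
  have [measurable]: "B \<epsilon> m \<in> sets M" for \<epsilon> m unfolding B_def by measurable
  have B: "prob (B \<epsilon> m) \<le> (\<Sum>i. v (i + m)) / \<epsilon>\<^sup>2" if "\<epsilon> > 0" for \<epsilon> m
  proof -
    interpret s: L2_martingale_differences M "\<lambda>n. F (n + m)" "\<lambda>n. d (n + m)" by (rule shift)
    show ?thesis
      using s.Kolmogorov_maximal_inequality_infinite[OF that] summable_ignore_initial_segment[OF sum, of m]
      by (simp add: B_def v_def s.S_def)
  qed
  have null: "prob (\<Inter>m. B \<epsilon> m) = 0" if "\<epsilon> > 0" for \<epsilon>
  proof -
    have "(\<lambda>m. (\<Sum>i. v (i + m)) / \<epsilon>\<^sup>2) \<longlonglongrightarrow> 0 / \<epsilon>\<^sup>2"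
      by (intro tendsto_divide suminf_exist_split2) (use sum that in \<open>auto simp: v_def\<close>)
    moreover have "prob (\<Inter>m. B \<epsilon> m) \<le> (\<Sum>i. v (i + m)) / \<epsilon>\<^sup>2" for m
      using B[OF that, of m] finite_measure_mono[of "\<Inter>m. B \<epsilon> m" "B \<epsilon> m"] by force
    ultimately have "prob (\<Inter>m. B \<epsilon> m) \<le> 0" by (auto intro: LIMSEQ_le_const)
    then show ?thesis by (simp add: measure_le_0_iff)
  qed
  have "AE x in M. x \<notin> (\<Inter>m. B \<epsilon> m)" if "\<epsilon> > 0" for \<epsilon>
    using null[OF that] by (intro AE_not_in null_setsI) (auto simp: emeasure_eq_measure)
  then have "AE x in M. \<forall>j::nat. x \<notin> (\<Inter>m. B (1 / Suc j) m)"
    by (simp add: AE_all_countable)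
  then show ?thesis
    using AE_space
  proof eventually_elim
    case (elim x)
    show "summable (\<lambda>i. d i x)"
      unfolding summable_Cauchy
    proof (intro allI impI)
      fix e :: real assume "e > 0"
      then obtain j where j: "1 / Suc j < e / 2" using nat_approx_posE[of "e / 2"] by auto
      from elim obtain m where m: "\<And>k. \<bar>\<Sum>i<k. d (i + m) x\<bar> < 1 / Suc j"
        by (auto simp: B_def not_le)
      have "norm (sum (\<lambda>i. d i x) {k..<n}) < e" if "k \<ge> m" for k n
      proof (cases "k \<le> n")
        case True
        have sh: "(\<Sum>i<l - m. d (i + m) x) = sum (\<lambda>i. d i x) {m..<l}" if "l \<ge> m" for l
          using that by (simp add: sum.atLeastLessThan_shift_0[of _ m l] lessThan_atLeast0 add.commute)
        have "sum (\<lambda>i. d i x) {m..<n} = sum (\<lambda>i. d i x) {m..<k} + sum (\<lambda>i. d i x) {k..<n}"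
          using True that by (simp add: sum.atLeastLessThan_concat)
        then show ?thesis
          using m[of "k - m"] m[of "n - m"] sh[of k] sh[of n] j True that by simp
      qed (use \<open>e > 0\<close> in simp)
      then show "\<exists>N. \<forall>m\<ge>N. \<forall>n. norm (sum (\<lambda>i. d i x) {m..<n}) < e" by blast
    qed
  qed
qed

subsection \<open>Truncation of a variable with finite moment of order \<open>r\<close>\<close>

definition trunc :: "real \<Rightarrow> real \<Rightarrow> real" where
  "trunc b x = (if \<bar>x\<bar> \<le> b then x else 0)"

lemma measurable_trunc [measurable]: "trunc b \<in> borel_measurable borel"
  unfolding trunc_def[abs_def] by measurable

lemma trunc_0 [simp]: "trunc b 0 = 0"
  by (simp add: trunc_def)

lemma trunc_minus [simp]: "trunc b (- x) = - trunc b x"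
  by (simp add: trunc_def)

lemma abs_trunc_le: "\<bar>trunc b x\<bar> \<le> \<bar>b\<bar>" "\<bar>trunc b x\<bar> \<le> \<bar>x\<bar>"
  by (auto simp: trunc_def)

lemma count_naturals_below_le:
  fixes y :: real
  assumes "y \<ge> 0"
  shows "(\<Sum>n<N. of_bool (real (n + 1) < y)) \<le> y"
proof -
  have "(\<Sum>n<N. of_bool (real (n + 1) < y)) \<le> y \<and> (\<Sum>n<N. of_bool (real (n + 1) < y)) \<le> real N"
    by (induction N) (use assms in auto)
  then show ?thesis ..
qed

lemma powr_telescope_bound:
  fixes q x :: real
  assumes "q > 1" "x > 0"
  shows "(x + 1) powr (- q) \<le> (x powr (1 - q) - (x + 1) powr (1 - q)) / (q - 1)"
proof -
  have "\<exists>z. x < z \<and> z < x + 1 \<and>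
      (x + 1) powr (1 - q) - x powr (1 - q) = (x + 1 - x) * ((1 - q) * z powr (- q))"
    by (rule MVT2) (use assms in \<open>auto intro!: derivative_eq_intros\<close>)
  then obtain z where z: "x < z" "z < x + 1" and
    eq: "(x + 1) powr (1 - q) - x powr (1 - q) = (1 - q) * z powr (- q)" by auto
  have "(x + 1) powr (- q) \<le> z powr (- q)"
    using z assms by (intro powr_mono2') auto
  then have "(q - 1) * (x + 1) powr (- q) \<le> (q - 1) * z powr (- q)"
    using assms by (intro mult_left_mono) auto
  then show ?thesis using eq assms by (simp add: field_simps)
qed

lemma powr_tail_sum_bound:
  fixes q y :: real
  assumes q: "q > 1" and y: "y \<ge> 0"
  shows "(\<Sum>n<N. of_bool (y \<le> real (n + 1)) * real (n + 1) powr (- q) * y powr q) \<le> (1 + 1 / (q - 1)) * (1 + y)"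
proof -
  define u where "u = max y 1"
  have u: "u \<ge> 1" "u \<ge> y" "u \<le> 1 + y" using y by (auto simp: u_def)
  define g where "g N = (if u \<le> real N then real N powr (1 - q) / (q - 1) else 0)" for N
  have *: "(\<Sum>n<N. of_bool (y \<le> real (n + 1)) * real (n + 1) powr (- q)) \<le> (1 + 1 / (q - 1)) * u powr (1 - q) - g N"
  proof (induction N)
    case 0
    then show ?case using u q by (simp add: g_def)
  next
    case (Suc N)
    have iff: "y \<le> real (k + 1) \<longleftrightarrow> u \<le> real (k + 1)" for k by (auto simp: u_def)
    consider "real (N + 1) < u" | "u \<le> real (N + 1)" "real N < u" | "u \<le> real N" by linarith
    then show ?case
    proof cases
      case 1
      then have "(\<Sum>n<Suc N. of_bool (y \<le> real (n + 1)) * real (n + 1) powr (- q)) = 0"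
        using iff by (intro sum.neutral) auto
      then show ?thesis using 1 q by (simp add: g_def)
    next
      case 2
      have "(\<Sum>n<N. of_bool (y \<le> real (n + 1)) * real (n + 1) powr (- q)) = 0"
        using 2 by (intro sum.neutral) (auto simp: u_def)
      moreover have "real (N + 1) powr (- q) \<le> real (N + 1) powr (1 - q)"
        by (intro powr_mono) auto
      moreover have "real (N + 1) powr (1 - q) \<le> u powr (1 - q)"
        using 2 u q by (intro powr_mono2') auto
      moreover from this have "real (N + 1) powr (1 - q) / (q - 1) \<le> u powr (1 - q) / (q - 1)"
        using q by (intro divide_right_mono) auto
      ultimately show ?thesis using 2 u by (simp add: g_def distrib_right)
    next
      case 3
      have "real (N + 1) powr (- q) \<le> (real N powr (1 - q) - real (N + 1) powr (1 - q)) / (q - 1)"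
        using powr_telescope_bound[OF q, of "real N"] 3 u by (simp add: add.commute)
      then show ?thesis using Suc 3 u by (simp add: g_def diff_divide_distrib add.commute)
    qed
  qed
  have "(\<Sum>n<N. of_bool (y \<le> real (n + 1)) * real (n + 1) powr (- q)) \<le> (1 + 1 / (q - 1)) * u powr (1 - q)"
  proof -
    have "0 \<le> g N" using q by (simp add: g_def)
    with * show ?thesis by simp
  qed
  then have "(\<Sum>n<N. of_bool (y \<le> real (n + 1)) * real (n + 1) powr (- q) * y powr q) \<le>
      (1 + 1 / (q - 1)) * u powr (1 - q) * y powr q"
    unfolding sum_distrib_right[symmetric] by (intro mult_right_mono) auto
  also have "\<dots> \<le> (1 + 1 / (q - 1)) * u powr (1 - q) * u powr q"
    using y u q by (intro mult_left_mono powr_mono2) auto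
  also have "\<dots> = (1 + 1 / (q - 1)) * u"
    using u by (simp add: mult.assoc powr_add[symmetric])
  also have "\<dots> \<le> (1 + 1 / (q - 1)) * (1 + y)"
    using u q by (intro mult_left_mono) auto
  finally show ?thesis .
qed

lemma summable_integral_of_bounded_partial_sums:
  fixes f :: "nat \<Rightarrow> 'a \<Rightarrow> real"
  assumes [measurable]: "\<And>n. f n \<in> borel_measurable M"
    and nonneg: "\<And>n x. 0 \<le> f n x"
    and bound: "\<And>N x. (\<Sum>n<N. f n x) \<le> g x"
    and g: "integrable M g"
  shows "summable (\<lambda>n. \<integral>x. f n x \<partial>M)"
proof -
  have int: "integrable M (f n)" for n
  proof (rule Bochner_Integration.integrable_bound[OF g])
    have "f n x \<le> g x" for x
    proof -
      have "f n x \<le> (\<Sum>k<Suc n. f k x)" using nonneg by (simp add: sum_nonneg)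
      with bound[where N = "Suc n" and x = x] show ?thesis by linarith
    qed
    then show "AE x in M. norm (f n x) \<le> norm (g x)"
      using nonneg[of n] by (intro AE_I2) (smt (verit) real_norm_def)
  qed simp
  show ?thesis
  proof (rule summableI_nonneg_bounded)
    fix N
    have "(\<Sum>n<N. \<integral>x. f n x \<partial>M) = (\<integral>x. (\<Sum>n<N. f n x) \<partial>M)"
      by (rule Bochner_Integration.integral_sum[symmetric]) (rule int)
    also have "\<dots> \<le> (\<integral>x. g x \<partial>M)"
      by (rule integral_mono[OF _ g bound]) (simp add: int)
    finally show "(\<Sum>n<N. \<integral>x. f n x \<partial>M) \<le> (\<integral>x. g x \<partial>M)" .
  qed (use nonneg in \<open>auto intro: integral_nonneg_AE\<close>)
qed

locale finite_moment = prob_space M for M :: "'a measure" +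
  fixes Y :: "'a \<Rightarrow> real" and r :: real
  assumes Y_measurable [measurable]: "Y \<in> borel_measurable M"
    and r: "1 < r" "r < 2"
    and moment: "integrable M (\<lambda>x. \<bar>Y x\<bar> powr r)"
begin

lemma le_root_iff: "\<bar>x\<bar> \<le> t powr (1 / r) \<longleftrightarrow> \<bar>x\<bar> powr r \<le> t" if "t \<ge> 0" for x t :: real
proof -
  have "(t powr (1 / r)) powr r = t" using r that by (simp add: powr_powr)
  moreover have "\<bar>x\<bar> powr r \<le> (t powr (1 / r)) powr r \<longleftrightarrow> \<bar>x\<bar> \<le> t powr (1 / r)"
    using r powr_mono2[of r "\<bar>x\<bar>" "t powr (1 / r)"] powr_less_mono2[of r "t powr (1 / r)" "\<bar>x\<bar>"]
    by (auto simp: not_le[symmetric])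
  ultimately show ?thesis by simp
qed

lemma summable_tail_probabilities:
  "summable (\<lambda>n. \<integral>x. (of_bool (\<bar>Y x\<bar> > real (n + 1) powr (1 / r)) :: real) \<partial>M)"
proof (rule summable_integral_of_bounded_partial_sums[OF _ _ _ moment])
  fix N x
  have "\<bar>Y x\<bar> > real (n + 1) powr (1 / r) \<longleftrightarrow> real (n + 1) < \<bar>Y x\<bar> powr r" for n
    using le_root_iff[of "real (n + 1)" "Y x"] by (simp add: not_le[symmetric])
  then show "(\<Sum>n<N. of_bool (\<bar>Y x\<bar> > real (n + 1) powr (1 / r))) \<le> \<bar>Y x\<bar> powr r"
    by (simp only:) (rule count_naturals_below_le, simp)
qed auto

lemma summable_truncated_second_moments:
  "summable (\<lambda>n. \<integral>x. real (n + 1) powr (- 2 / r) * (trunc (real (n + 1) powr (1 / r)) (Y x))\<^sup>2 \<partial>M)"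
proof (rule summable_integral_of_bounded_partial_sums)
  have q: "2 / r > 1" using r by simp
  show "integrable M (\<lambda>x. (1 + 1 / (2 / r - 1)) * (1 + \<bar>Y x\<bar> powr r))"
    using moment by simp
  fix N x
  have "real (n + 1) powr (- 2 / r) * (trunc (real (n + 1) powr (1 / r)) (Y x))\<^sup>2 =
      of_bool (\<bar>Y x\<bar> powr r \<le> real (n + 1)) * real (n + 1) powr (- (2 / r)) * (\<bar>Y x\<bar> powr r) powr (2 / r)" for n
  proof -
    have "(\<bar>Y x\<bar> powr r) powr (2 / r) = (Y x)\<^sup>2" using r by (simp add: powr_powr)
    then show ?thesis using le_root_iff[of "real (n + 1)" "Y x"] by (simp add: trunc_def)
  qed
  then show "(\<Sum>n<N. real (n + 1) powr (- 2 / r) * (trunc (real (n + 1) powr (1 / r)) (Y x))\<^sup>2) \<le>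
      (1 + 1 / (2 / r - 1)) * (1 + \<bar>Y x\<bar> powr r)"
    by (simp only:) (rule powr_tail_sum_bound[OF q], simp)
qed auto

lemma abs_le_moment: "\<bar>x\<bar> \<le> 1 + \<bar>x\<bar> powr r" for x :: real
proof (cases "\<bar>x\<bar> \<le> 1")
  case False
  then show ?thesis using powr_mono[of 1 r "\<bar>x\<bar>"] r by simp
qed (simp add: add_increasing2)

lemma integrable_Y: "integrable M Y"
proof (rule Bochner_Integration.integrable_bound)
  show "integrable M (\<lambda>x. 1 + \<bar>Y x\<bar> powr r)" using moment by simp
qed (use abs_le_moment in auto)

lemma truncated_mean_rate:
  "(\<lambda>n. real n powr (1 - 1 / r) * (expectation Y - expectation (\<lambda>x. trunc (real n powr (1 / r)) (Y x)))) \<longlonglongrightarrow> 0"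
proof -
  let ?g = "\<lambda>n x. real n powr (1 - 1 / r) * (Y x - trunc (real n powr (1 / r)) (Y x))"
  have int: "integrable M (\<lambda>x. trunc b (Y x))" for b
    by (rule Bochner_Integration.integrable_bound[OF integrable_Y]) (auto simp: abs_trunc_le)
  have "(\<lambda>n. \<integral>x. ?g n x \<partial>M) \<longlonglongrightarrow> (\<integral>x. 0 \<partial>M)"
  proof (rule integral_dominated_convergence[OF _ _ moment])
    show "AE x in M. (\<lambda>n. ?g n x) \<longlonglongrightarrow> 0"
    proof (rule AE_I2)
      fix x
      have "\<forall>\<^sub>F n in sequentially. real n \<ge> \<bar>Y x\<bar> powr r" by real_asymp
      then have "\<forall>\<^sub>F n in sequentially. ?g n x = 0"
        by eventually_elim (use le_root_iff[of "real _" "Y x"] in \<open>simp add: trunc_def\<close>)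
      then show "(\<lambda>n. ?g n x) \<longlonglongrightarrow> 0" by (rule tendsto_eventually)
    qed
    fix n
    show "AE x in M. norm (?g n x) \<le> \<bar>Y x\<bar> powr r"
    proof (rule AE_I2)
      fix x
      show "norm (?g n x) \<le> \<bar>Y x\<bar> powr r"
      proof (cases "\<bar>Y x\<bar> \<le> real n powr (1 / r)")
        case False
        then have n: "real n \<le> \<bar>Y x\<bar> powr r" using le_root_iff[of "real n" "Y x"] by simp
        have Y0: "\<bar>Y x\<bar> > 0" using False le_less_trans[OF powr_ge_zero] not_le by blast
        have "real n powr (1 - 1 / r) * \<bar>Y x\<bar> \<le> (\<bar>Y x\<bar> powr r) powr (1 - 1 / r) * \<bar>Y x\<bar>"
          using n r by (intro mult_right_mono powr_mono2) auto
        also have "\<dots> = \<bar>Y x\<bar> powr (r - 1) * \<bar>Y x\<bar> powr 1"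
          using r Y0 by (simp add: powr_powr right_diff_distrib)
        also have "\<dots> = \<bar>Y x\<bar> powr r"
          unfolding powr_add[symmetric] by simp
        finally show ?thesis using False by (simp add: trunc_def abs_mult)
      qed (simp add: trunc_def)
    qed
  qed auto
  then show ?thesis using integrable_Y int by simp
qed

end

subsection \<open>The reinforced walk\<close>

context step_reinforced_walk
begin

definition Z :: "nat \<times> nat \<Rightarrow> 'w \<Rightarrow> real" where
  "Z j = ([\<xi>, \<lambda>n \<omega>. real (U n \<omega>), \<gamma>, \<rho>] ! fst j) (snd j)"

lemma Z_simps [simp]:
  "Z (0, n) = \<xi> n" "Z (Suc 0, n) = (\<lambda>\<omega>. real (U n \<omega>))" "Z (2, n) = \<gamma> n" "Z (3, n) = \<rho> n"
  by (simp_all add: Z_def)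

lemma indep_Z_row: "i < 4 \<Longrightarrow> indep_vars (\<lambda>_. borel) (\<lambda>n. Z (i, n)) {1..}"
proof -
  assume "i < 4"
  then consider "i = 0" | "i = Suc 0" | "i = 2" | "i = 3" by linarith
  then show ?thesis
  proof cases
    case 2
    show ?thesis unfolding 2 Z_simps by (rule indep_vars_compose2[OF indep_U]) simp
  qed (simp_all only: Z_simps indep_xi indep_gamma indep_rho)
qed

lemma measurable_Z: "j \<in> {..<4} \<times> {1..} \<Longrightarrow> Z j \<in> borel_measurable M"
  using indep_Z_row[of "fst j"] by (auto simp: indep_vars_def)

lemma indep_Z: "indep_vars (\<lambda>_. borel) Z ({..<4} \<times> {1..})"
  unfolding indep_vars_def2
proof (intro conjI ballI measurable_Z indep_setsI)
  fix j :: "nat \<times> nat" assume "j \<in> {..<4} \<times> {1..}"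
  then show "{Z j -` A \<inter> space M |A. A \<in> sets borel} \<subseteq> events"
    using measurable_Z[of j] by (auto intro: measurable_sets)
next
  fix A and J :: "(nat \<times> nat) set"
  assume J: "J \<noteq> {}" "J \<subseteq> {..<4} \<times> {1..}" "finite J"
    and "\<forall>j\<in>J. A j \<in> {Z j -` A \<inter> space M |A. A \<in> sets borel}"
  then have "\<forall>j\<in>J. \<exists>E. A j = Z j -` E \<inter> space M \<and> E \<in> sets borel" by auto
  then obtain E where E: "\<And>j. j \<in> J \<Longrightarrow> A j = Z j -` E j \<inter> space M" "\<And>j. j \<in> J \<Longrightarrow> E j \<in> sets borel"
    by metis
  define L where "L = fst ` J"
  define K where "K i = {k. (i, k) \<in> J}" for i
  have JK: "J = Sigma L K" by (force simp: L_def K_def)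
  have fin: "finite L" "finite (K i)" for i
  proof -
    have "K i \<subseteq> snd ` J" by (force simp: K_def)
    then show "finite (K i)" using J(3) finite_subset by blast
  qed (use J(3) in \<open>simp add: L_def\<close>)
  have L: "L \<subseteq> {..<4}" "L \<noteq> {}" and K: "K i \<subseteq> {1..}" for i using J by (auto simp: L_def K_def)
  have Kne: "K i \<noteq> {}" if "i \<in> L" for i using that by (auto simp: L_def K_def)
  define s where "s i \<omega> = (\<lambda>n\<in>{1..}. ([\<xi>, \<lambda>n \<omega>. real (U n \<omega>), \<gamma>, \<rho>] ! i) n \<omega>)" for i \<omega>
  define B where "B i = {f \<in> space (Pi\<^sub>M {1..} (\<lambda>_. borel)). \<forall>k\<in>K i. f k \<in> E (i, k)}" for i
  have B: "B i \<in> sets (Pi\<^sub>M {1..} (\<lambda>_. borel :: real measure))" if "i \<in> L" for i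
    unfolding B_def
  proof (intro sets.sets_Collect_finite_All fin)
    fix k assume k: "k \<in> K i"
    then have [measurable]: "E (i, k) \<in> sets borel" using E by (auto simp: K_def)
    have [measurable]: "k \<in> {1..}" using k K by auto
    show "{f \<in> space (Pi\<^sub>M {1..} (\<lambda>_. borel)). f k \<in> E (i, k)} \<in> sets (Pi\<^sub>M {1..} (\<lambda>_. borel))"
      by measurable
  qed
  have sB: "s i -` B i \<inter> space M = (\<Inter>k\<in>K i. A (i, k))" if "i \<in> L" for i
  proof -
    have "A (i, k) = Z (i, k) -` E (i, k) \<inter> space M" if "k \<in> K i" for k
      using E that by (auto simp: K_def)
    moreover have "s i \<omega> k = Z (i, k) \<omega>" if "k \<in> K i" for k \<omega>
      using that K by (auto simp: s_def Z_def)
    moreover have "s i \<omega> \<in> space (Pi\<^sub>M {1..} (\<lambda>_. borel))" for \<omega>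
      by (auto simp: s_def space_PiM)
    ultimately show ?thesis using Kne[OF that] by (auto simp: B_def)
  qed
  have "prob (\<Inter>j\<in>J. A j) = prob (\<Inter>i\<in>L. s i -` B i \<inter> space M)"
    using sB L(2) Kne unfolding JK by (intro arg_cong[where f = prob]) auto
  also have "\<dots> = (\<Prod>i\<in>L. prob (s i -` B i \<inter> space M))"
    by (rule indep_varsD[OF indep_sequences[folded s_def]]) (use L fin B in auto)
  also have "\<dots> = (\<Prod>i\<in>L. \<Prod>k\<in>K i. prob (A (i, k)))"
  proof (rule prod.cong[OF refl])
    fix i assume i: "i \<in> L"
    have Ak: "A (i, k) = Z (i, k) -` E (i, k) \<inter> space M" if "k \<in> K i" for k
      using E that by (auto simp: K_def)
    have "prob (\<Inter>k\<in>K i. Z (i, k) -` E (i, k) \<inter> space M) = (\<Prod>k\<in>K i. prob (Z (i, k) -` E (i, k) \<inter> space M))"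
      by (rule indep_varsD[OF indep_Z_row]) (use i L fin K E Kne in \<open>auto simp: K_def\<close>)
    then show "prob (s i -` B i \<inter> space M) = (\<Prod>k\<in>K i. prob (A (i, k)))"
      unfolding sB[OF i] using Ak by (simp cong: prod.cong INF_cong_simp)
  qed
  also have "\<dots> = (\<Prod>j\<in>J. prob (A j))"
    unfolding JK by (subst prod.Sigma) (use fin in auto)
  finally show "prob (\<Inter>j\<in>J. A j) = (\<Prod>j\<in>J. prob (A j))" .
qed

definition gen :: "(nat \<times> nat) set \<Rightarrow> 'w measure" where
  "gen J = sigma (space M) (\<Union>j\<in>J. {Z j -` A \<inter> space M | A. A \<in> sets borel})"

lemma space_gen [simp]: "space (gen J) = space M"
  by (simp add: gen_def space_measure_of_conv)

lemma sets_gen: "sets (gen J) = sigma_sets (space M) (\<Union>j\<in>J. {Z j -` A \<inter> space M | A. A \<in> sets borel})"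
  unfolding gen_def by (rule sets_measure_of) auto

lemma sets_gen_mono: "J \<subseteq> J' \<Longrightarrow> sets (gen J) \<subseteq> sets (gen J')"
  unfolding sets_gen by (intro sigma_sets_mono') auto

lemma measurable_Z_gen: "j \<in> J \<Longrightarrow> Z j \<in> borel_measurable (gen J)"
  by (rule measurableI) (auto simp: sets_gen intro!: sigma_sets.Basic)

lemma subalgebra_gen: "J \<subseteq> {..<4} \<times> {1..} \<Longrightarrow> subalgebra M (gen J)"
  unfolding subalgebra_def sets_gen using measurable_Z
  by (auto intro!: sets.sigma_sets_subset intro: measurable_sets)

lemma indep_vars_gen:
  assumes K: "(\<Union>l\<in>L. K l) \<subseteq> {..<4} \<times> {1..}" "disjoint_family_on K L"
    and f: "\<And>l. l \<in> L \<Longrightarrow> f l \<in> borel_measurable (gen (K l))"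
  shows "indep_vars (\<lambda>_. borel) f L"
  unfolding indep_vars_def2
proof (intro conjI ballI)
  fix l assume l: "l \<in> L"
  then have "subalgebra M (gen (K l))" using K by (intro subalgebra_gen) auto
  then show "random_variable borel (f l)" using f[OF l] measurable_from_subalg by blast
next
  have "indep_sets (\<lambda>l. sigma_sets (space M) (\<Union>j\<in>K l. {Z j -` A \<inter> space M | A. A \<in> sets borel})) L"
  proof (rule indep_sets_collect_sigma[OF _ _ K(2)])
    show "indep_sets (\<lambda>j. {Z j -` A \<inter> space M |A. A \<in> sets borel}) (\<Union>l\<in>L. K l)"
      using indep_Z K(1) unfolding indep_vars_def2 by (blast intro: indep_sets_mono_index)
    show "Int_stable {Z i -` A \<inter> space M |A. A \<in> sets borel}" for i
      unfolding Int_stable_def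
    proof safe
      fix A B :: "real set" assume "A \<in> sets borel" "B \<in> sets borel"
      then show "\<exists>C. Z i -` A \<inter> space M \<inter> (Z i -` B \<inter> space M) = Z i -` C \<inter> space M \<and> C \<in> sets borel"
        by (intro exI[of _ "A \<inter> B"]) auto
    qed
  qed
  then show "indep_sets (\<lambda>l. {f l -` A \<inter> space M |A. A \<in> sets borel}) L"
    unfolding sets_gen[symmetric]
  proof (rule indep_sets_mono_sets)
    fix l assume "l \<in> L"
    then show "{f l -` A \<inter> space M |A. A \<in> sets borel} \<subseteq> sets (gen (K l))"
      using measurable_sets[OF f] by auto
  qed
qed

definition past :: "nat \<Rightarrow> (nat \<times> nat) set" where
  "past n = {0} \<times> {1..n} \<union> {1, 2, 3} \<times> {1..<n}"

abbreviation F :: "nat \<Rightarrow> 'w measure" where "F n \<equiv> gen (past n)"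

lemma past_subset: "past n \<subseteq> {..<4} \<times> {1..}"
  by (auto simp: past_def)

lemma subalgebra_F: "subalgebra M (F n)"
  by (rule subalgebra_gen[OF past_subset])

lemma measurable_F: "f \<in> borel_measurable (F n) \<Longrightarrow> f \<in> borel_measurable M"
  by (rule measurable_from_subalg[OF subalgebra_F])

lemma sets_F_mono: "m \<le> n \<Longrightarrow> sets (F m) \<subseteq> sets (F n)"
  by (rule sets_gen_mono) (auto simp: past_def)

lemma measurable_F_mono: "m \<le> n \<Longrightarrow> f \<in> borel_measurable (F m) \<Longrightarrow> f \<in> borel_measurable (F n)"
  by (rule measurable_from_subalg[where F = "F m"]) (auto simp: subalgebra_def intro: sets_F_mono[THEN subsetD])

lemma expectation_past_innovations:
  fixes \<Psi> :: "'w \<Rightarrow> real" and g0 g1 g2 g3 :: "real \<Rightarrow> real"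
  assumes n: "n \<ge> 1"
    and \<Psi>: "\<Psi> \<in> borel_measurable (F n)"
    and g: "g0 \<in> borel_measurable borel" "g1 \<in> borel_measurable borel"
      "g2 \<in> borel_measurable borel" "g3 \<in> borel_measurable borel"
    and bounded: "\<And>\<omega>. \<bar>\<Psi> \<omega>\<bar> \<le> C" "\<And>x. \<bar>g0 x\<bar> \<le> C" "\<And>x. \<bar>g1 x\<bar> \<le> C" "\<And>x. \<bar>g2 x\<bar> \<le> C" "\<And>x. \<bar>g3 x\<bar> \<le> C"
  shows "expectation (\<lambda>\<omega>. \<Psi> \<omega> * g0 (\<xi> (Suc n) \<omega>) * g1 (real (U n \<omega>)) * g2 (\<gamma> n \<omega>) * g3 (\<rho> n \<omega>)) =
    expectation \<Psi> * expectation (\<lambda>\<omega>. g0 (\<xi> (Suc n) \<omega>)) * expectation (\<lambda>\<omega>. g1 (real (U n \<omega>))) *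
    expectation (\<lambda>\<omega>. g2 (\<gamma> n \<omega>)) * expectation (\<lambda>\<omega>. g3 (\<rho> n \<omega>))"
proof -
  define f where "f l = [\<Psi>, \<lambda>\<omega>. g0 (Z (0, Suc n) \<omega>), \<lambda>\<omega>. g1 (Z (1, n) \<omega>), \<lambda>\<omega>. g2 (Z (2, n) \<omega>), \<lambda>\<omega>. g3 (Z (3, n) \<omega>)] ! l" for l
  define K where "K l = [past n, {(0, Suc n)}, {(1, n)}, {(2, n)}, {(3, n)}] ! l" for l
  have five: "{..<5} = {0, 1, 2, 3, 4 :: nat}" by auto
  have meas: "f l \<in> borel_measurable (gen (K l))" if "l \<in> {..<5}" for l
    using that \<Psi> g unfolding five
    by (auto simp: f_def K_def simp del: Z_simps intro!: measurable_compose[OF measurable_Z_gen])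
  have indep: "indep_vars (\<lambda>_. borel) f {..<5}"
  proof (rule indep_vars_gen[where K = K])
    show "(\<Union>l\<in>{..<5}. K l) \<subseteq> {..<4} \<times> {1..}"
      using past_subset[of n] n by (auto simp: five K_def)
    show "disjoint_family_on K {..<5}"
      unfolding disjoint_family_on_def five by (simp add: K_def past_def)
  qed (rule meas)
  have int: "integrable M (f l)" if "l \<in> {..<5}" for l
    by (rule integrable_const_bound[of "f l" C])
      (use indep that bounded in \<open>auto simp: indep_vars_def five f_def\<close>)
  have "expectation (\<lambda>\<omega>. \<Prod>l\<in>{..<5}. f l \<omega>) = (\<Prod>l\<in>{..<5}. expectation (f l))"
    by (rule indep_vars_lebesgue_integral) (use indep int in auto)
  then show ?thesis by (simp add: five f_def mult.assoc)
qed

text \<open>A measurable version of \<open>X\<close>: the locale does not force \<open>X n\<close> to be measurable on the null set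
  where \<open>U\<close> leaves its range.\<close>

fun Y :: "nat \<Rightarrow> 'w \<Rightarrow> real" where
  "Y 0 \<omega> = 0"
| "Y (Suc n) \<omega> = (if n = 0 then \<xi> 1 \<omega>
     else if \<gamma> n \<omega> = 1 then (if \<rho> n \<omega> = 1 then 1 else - 1) * (\<Sum>k\<in>{1..n}. if real (U n \<omega>) = real k then Y k \<omega> else 0)
     else \<xi> (Suc n) \<omega>)"

declare Y.simps(2) [simp del]

lemma Y_eq_select:
  assumes "n \<ge> 1" "k \<in> {1..n}" "U n \<omega> = k"
  shows "Y (Suc n) \<omega> = (if \<gamma> n \<omega> = 1 then (if \<rho> n \<omega> = 1 then Y k \<omega> else - Y k \<omega>) else \<xi> (Suc n) \<omega>)"
  using assms by (simp add: Y.simps(2))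

lemma Y_adapted: "k \<le> n \<Longrightarrow> Y k \<in> borel_measurable (F n)"
proof (induction k rule: less_induct)
  case (less k)
  show ?case
  proof (cases k)
    case 0
    then show ?thesis by simp
  next
    case (Suc m)
    have \<xi>: "\<xi> (Suc m) \<in> borel_measurable (F n)"
      using measurable_Z_gen[of "(0, Suc m)" "past n"] less.prems Suc by (simp add: past_def)
    show ?thesis
    proof (cases "m = 0")
      case True
      then show ?thesis using \<xi> by (simp add: Suc Y.simps(2)[abs_def])
    next
      case False
      have [measurable]: "\<gamma> m \<in> borel_measurable (F n)" "\<rho> m \<in> borel_measurable (F n)"
          "(\<lambda>\<omega>. real (U m \<omega>)) \<in> borel_measurable (F n)"
        using measurable_Z_gen[of "(2, m)" "past n"] measurable_Z_gen[of "(3, m)" "past n"]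
          measurable_Z_gen[of "(1, m)" "past n"] less.prems Suc False by (auto simp: past_def)
      note \<xi> [measurable]
      have [measurable]: "(\<lambda>\<omega>. \<Sum>k\<in>{1..m}. if real (U m \<omega>) = real k then Y k \<omega> else 0) \<in> borel_measurable (F n)"
      proof (intro borel_measurable_sum)
        fix k assume "k \<in> {1..m}"
        then have [measurable]: "Y k \<in> borel_measurable (F n)" using less Suc by simp
        show "(\<lambda>\<omega>. if real (U m \<omega>) = real k then Y k \<omega> else 0) \<in> borel_measurable (F n)" by measurable
      qed
      show ?thesis unfolding Suc Y.simps(2)[abs_def] if_not_P[OF False] by measurable
    qed
  qed
qed

lemma measurable_Y [measurable]: "Y k \<in> borel_measurable M"
  by (rule measurable_F[OF Y_adapted[OF order_refl]])

lemma measurable_inputs: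
  assumes "n \<ge> 1"
  shows "\<xi> n \<in> borel_measurable M" "U n \<in> measurable M (count_space UNIV)"
    "\<gamma> n \<in> borel_measurable M" "\<rho> n \<in> borel_measurable M"
  using indep_xi indep_U indep_gamma indep_rho assms by (auto simp: indep_vars_def)

lemma prob_U:
  assumes "n \<ge> 1" "k \<in> {1..n}"
  shows "prob {\<omega> \<in> space M. U n \<omega> = k} = 1 / n"
proof -
  note measurable_inputs(2)[OF assms(1), measurable]
  have "prob {\<omega> \<in> space M. U n \<omega> = k} = measure (distr M (count_space UNIV) (U n)) {k}"
    by (subst measure_distr) (auto intro!: arg_cong[where f = prob])
  also have "\<dots> = 1 / n" using assms by (simp add: law_U measure_pmf_single)
  finally show ?thesis .
qed

lemma expectation_xi:
  assumes "n \<ge> 1" "f \<in> borel_measurable borel"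
  shows "expectation (\<lambda>\<omega>. f (\<xi> n \<omega>)) = (expectation (\<lambda>\<omega>. f (\<xi> 1 \<omega>)) :: real)"
  using integral_distr[OF measurable_inputs(1)[OF assms(1)] assms(2)]
    integral_distr[OF measurable_inputs(1)[of 1] assms(2)] law_xi[OF assms(1)] by simp

lemma expectation_inputs:
  assumes n: "n \<ge> 1"
  shows "k \<in> {1..n} \<Longrightarrow> expectation (\<lambda>\<omega>. of_bool (real (U n \<omega>) = real k)) = 1 / n"
    "expectation (\<lambda>\<omega>. of_bool (\<gamma> n \<omega> = 1)) = \<alpha>" "expectation (\<lambda>\<omega>. of_bool (\<gamma> n \<omega> \<noteq> 1)) = 1 - \<alpha>"
    "expectation (\<lambda>\<omega>. of_bool (\<rho> n \<omega> = 1)) = p" "expectation (\<lambda>\<omega>. of_bool (\<rho> n \<omega> \<noteq> 1)) = 1 - p"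
proof -
  note measurable_inputs[OF n, measurable]
  have *: "expectation (\<lambda>\<omega>. of_bool (P \<omega>) :: real) = prob {\<omega> \<in> space M. P \<omega>}"
    if "{\<omega> \<in> space M. P \<omega>} \<in> events" for P
  proof -
    have "expectation (\<lambda>\<omega>. of_bool (P \<omega>) :: real) = expectation (indicator {\<omega> \<in> space M. P \<omega>})"
      by (rule Bochner_Integration.integral_cong) (auto simp: indicator_def)
    then show ?thesis using that by simp
  qed
  show "expectation (\<lambda>\<omega>. of_bool (real (U n \<omega>) = real k)) = 1 / n" if "k \<in> {1..n}"
    using prob_U[OF n that] by (subst *) auto
  show \<gamma>: "expectation (\<lambda>\<omega>. of_bool (\<gamma> n \<omega> = 1)) = \<alpha>" using law_gamma(1)[OF n] by (subst *) auto
  show \<rho>: "expectation (\<lambda>\<omega>. of_bool (\<rho> n \<omega> = 1)) = p" using law_rho(1)[OF n] by (subst *) auto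
  have neg: "(of_bool (\<not> P) :: real) = 1 - of_bool P" for P by simp
  have "integrable M (\<lambda>\<omega>. of_bool (\<gamma> n \<omega> = 1) :: real)" "integrable M (\<lambda>\<omega>. of_bool (\<rho> n \<omega> = 1) :: real)"
    by (rule integrable_const_bound[of _ 1]; simp)+
  then show "expectation (\<lambda>\<omega>. of_bool (\<gamma> n \<omega> \<noteq> 1)) = 1 - \<alpha>" "expectation (\<lambda>\<omega>. of_bool (\<rho> n \<omega> \<noteq> 1)) = 1 - p"
    unfolding neg using \<gamma> \<rho> prob_space by simp_all
qed

lemma AE_inputs_in_range:
  "AE \<omega> in M. \<forall>n\<ge>1. U n \<omega> \<in> {1..n} \<and> (\<gamma> n \<omega> = 0 \<or> \<gamma> n \<omega> = 1) \<and> (\<rho> n \<omega> = 1 \<or> \<rho> n \<omega> = - 1)"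
proof -
  have two: "AE \<omega> in M. V \<omega> = a \<or> V \<omega> = b"
    if [measurable]: "V \<in> borel_measurable M" and "a \<noteq> b"
      and "prob {\<omega> \<in> space M. V \<omega> = a} + prob {\<omega> \<in> space M. V \<omega> = b} = 1" for V and a b :: real
  proof -
    have "prob ({\<omega> \<in> space M. V \<omega> = a} \<union> {\<omega> \<in> space M. V \<omega> = b}) = 1"
      using that by (subst finite_measure_Union) auto
    from AE_prob_1[OF this] show ?thesis by eventually_elim auto
  qed
  have "AE \<omega> in M. U n \<omega> \<in> {1..n} \<and> (\<gamma> n \<omega> = 0 \<or> \<gamma> n \<omega> = 1) \<and> (\<rho> n \<omega> = 1 \<or> \<rho> n \<omega> = - 1)" if n: "n \<ge> 1" for n
  proof -
    note measurable_inputs[OF n, measurable]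
    have "AE x in distr M (count_space UNIV) (U n). x \<in> {1..n}"
      unfolding law_U[OF n] using n by (simp add: AE_measure_pmf_iff)
    then have "AE \<omega> in M. U n \<omega> \<in> {1..n}" by (subst (asm) AE_distr_iff) auto
    moreover have "AE \<omega> in M. \<gamma> n \<omega> = 0 \<or> \<gamma> n \<omega> = 1" using law_gamma[OF n] by (intro two) auto
    moreover have "AE \<omega> in M. \<rho> n \<omega> = 1 \<or> \<rho> n \<omega> = - 1" using law_rho[OF n] by (intro two) auto
    ultimately show ?thesis by eventually_elim auto
  qed
  then show ?thesis by (simp add: AE_all_countable)
qed

lemma AE_X_eq_Y: "AE \<omega> in M. \<forall>n\<ge>1. X n \<omega> = Y n \<omega>"
  using AE_inputs_in_range AE_space
proof eventually_elim
  case (elim \<omega>)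
  have "X n \<omega> = Y n \<omega>" if "n \<ge> 1" for n
    using that
  proof (induction n rule: less_induct)
    case (less n)
    show ?case
    proof (cases "n = 1")
      case True
      have "Y 1 \<omega> = \<xi> 1 \<omega>" by (simp add: Y.simps(2))
      then show ?thesis unfolding True X_first[OF elim(2)] ..
    next
      case False
      then obtain m where m: "n = Suc m" "m \<ge> 1" using less.prems by (cases n) auto
      have r: "U m \<omega> \<in> {1..m}" "\<gamma> m \<omega> = 0 \<or> \<gamma> m \<omega> = 1" "\<rho> m \<omega> = 1 \<or> \<rho> m \<omega> = - 1"
        using elim(1)[rule_format, OF m(2)] by blast+
      have XU: "X (U m \<omega>) \<omega> = Y (U m \<omega>) \<omega>"
        by (rule less.IH) (use r(1) m in simp_all)
      show ?thesis
        using X_step[OF m(2) elim(2)] r(2,3)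
        unfolding m(1) XU Y_eq_select[OF m(2) r(1) refl] Suc_eq_plus1[symmetric] by auto
    qed
  qed
  then show ?case by blast
qed

lemma expectation_next_step:
  fixes \<Psi> :: "'w \<Rightarrow> real" and f :: "real \<Rightarrow> real"
  assumes n: "n \<ge> 1" and \<Psi>: "\<Psi> \<in> borel_measurable (F n)" "\<And>\<omega>. \<bar>\<Psi> \<omega>\<bar> \<le> C"
    and f [measurable]: "f \<in> borel_measurable borel" and f_bound: "\<And>x. \<bar>f x\<bar> \<le> B" and f0: "f 0 = 0"
  shows "expectation (\<lambda>\<omega>. \<Psi> \<omega> * f (Y (Suc n) \<omega>)) =
    \<alpha> / n * (\<Sum>k\<in>{1..n}. p * expectation (\<lambda>\<omega>. \<Psi> \<omega> * f (Y k \<omega>)) + (1 - p) * expectation (\<lambda>\<omega>. \<Psi> \<omega> * f (- Y k \<omega>))) +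
    (1 - \<alpha>) * expectation \<Psi> * expectation (\<lambda>\<omega>. f (\<xi> 1 \<omega>))"
proof -
  let ?E = expectation
  note measurable_inputs[OF n, measurable] measurable_F[OF \<Psi>(1), measurable]
  have [measurable]: "\<xi> (Suc n) \<in> borel_measurable M" using measurable_inputs(1)[of "Suc n"] n by simp
  have C: "C \<ge> 0" and B: "B \<ge> 0" using \<Psi>(2) f_bound abs_ge_zero order_trans by blast+
  define P where "P s k \<omega> = \<Psi> \<omega> * f (s * Y k \<omega>)" for s k \<omega>
  have PF: "P s k \<in> borel_measurable (F n)" if "k \<in> {1..n}" for s k
  proof -
    have [measurable]: "Y k \<in> borel_measurable (F n)" using Y_adapted that by auto
    show ?thesis unfolding P_def[abs_def] using \<Psi>(1) by measurable
  qed
  have [measurable]: "P s k \<in> borel_measurable M" for s k unfolding P_def[abs_def] by measurable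
  have P_bound: "\<bar>P s k \<omega>\<bar> \<le> C * B" for s k \<omega>
    unfolding P_def abs_mult using \<Psi>(2) f_bound C by (intro mult_mono) auto
  define u g1 g0 r1 r0 :: "nat \<Rightarrow> 'w \<Rightarrow> real"
    where "u k \<omega> = of_bool (real (U n \<omega>) = real k)" and "g1 k \<omega> = of_bool (\<gamma> n \<omega> = 1)"
      and "g0 k \<omega> = of_bool (\<gamma> n \<omega> \<noteq> 1)"
      and "r1 k \<omega> = of_bool (\<rho> n \<omega> = 1)" and "r0 k \<omega> = of_bool (\<rho> n \<omega> \<noteq> 1)" for k \<omega>
  note d = u_def g1_def g0_def r1_def r0_def
  let ?D = "C * B + C + B + 1"
  have D: "C * B \<le> ?D" "C \<le> ?D" "B \<le> ?D" "1 \<le> ?D" "0 \<le> ?D" using C B by auto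
  have t1: "?E (\<lambda>\<omega>. P 1 k \<omega> * u k \<omega> * g1 k \<omega> * r1 k \<omega>) = ?E (P 1 k) * (1 / n) * \<alpha> * p" if k: "k \<in> {1..n}" for k
    using expectation_past_innovations[OF n PF[OF k, of 1], where C = ?D and ?g0.0 = "\<lambda>_. 1"
        and ?g1.0 = "\<lambda>x. of_bool (x = real k)" and ?g2.0 = "\<lambda>x. of_bool (x = 1)" and ?g3.0 = "\<lambda>x. of_bool (x = 1)"]
      order_trans[OF P_bound D(1)] D expectation_inputs[OF n] k
    by (simp add: d prob_space)
  have t2: "?E (\<lambda>\<omega>. P (- 1) k \<omega> * u k \<omega> * g1 k \<omega> * r0 k \<omega>) = ?E (P (- 1) k) * (1 / n) * \<alpha> * (1 - p)" if k: "k \<in> {1..n}" for k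
    using expectation_past_innovations[OF n PF[OF k, of "- 1"], where C = ?D and ?g0.0 = "\<lambda>_. 1"
        and ?g1.0 = "\<lambda>x. of_bool (x = real k)" and ?g2.0 = "\<lambda>x. of_bool (x = 1)" and ?g3.0 = "\<lambda>x. of_bool (x \<noteq> 1)"]
      order_trans[OF P_bound D(1)] D expectation_inputs[OF n] k
    by (simp add: d prob_space)
  have t3: "?E (\<lambda>\<omega>. \<Psi> \<omega> * f (\<xi> (Suc n) \<omega>) * g0 0 \<omega>) = ?E \<Psi> * ?E (\<lambda>\<omega>. f (\<xi> 1 \<omega>)) * (1 - \<alpha>)"
    using expectation_past_innovations[OF n \<Psi>(1), where C = ?D and ?g0.0 = f
        and ?g1.0 = "\<lambda>x. 1" and ?g2.0 = "\<lambda>x. of_bool (x \<noteq> 1)" and ?g3.0 = "\<lambda>x. 1"]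
      order_trans[OF \<Psi>(2) D(2)] order_trans[OF f_bound D(3)] D expectation_inputs[OF n] expectation_xi[of "Suc n" f]
    by (simp add: d prob_space)
  have int: "integrable M h" if "h \<in> borel_measurable M" "\<And>\<omega>. \<bar>h \<omega>\<bar> \<le> ?D" for h :: "'w \<Rightarrow> real"
    by (rule integrable_const_bound[of _ ?D]) (use that in auto)
  have i1: "integrable M (\<lambda>\<omega>. P 1 k \<omega> * u k \<omega> * g1 k \<omega> * r1 k \<omega>)" for k
    by (rule int) (use order_trans[OF P_bound D(1)] D in \<open>auto simp: d\<close>)
  have i2: "integrable M (\<lambda>\<omega>. P (- 1) k \<omega> * u k \<omega> * g1 k \<omega> * r0 k \<omega>)" for k
    by (rule int) (use order_trans[OF P_bound D(1)] D in \<open>auto simp: d\<close>)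
  have i3: "integrable M (\<lambda>\<omega>. \<Psi> \<omega> * f (\<xi> (Suc n) \<omega>) * g0 0 \<omega>)"
  proof (rule int)
    fix \<omega>
    have "\<bar>\<Psi> \<omega> * f (\<xi> (Suc n) \<omega>)\<bar> \<le> C * B" unfolding abs_mult using \<Psi>(2) f_bound C by (intro mult_mono) auto
    then show "\<bar>\<Psi> \<omega> * f (\<xi> (Suc n) \<omega>) * g0 0 \<omega>\<bar> \<le> ?D" using D by (auto simp: d)
  qed (simp add: d)
  have "?E (\<lambda>\<omega>. \<Psi> \<omega> * f (Y (Suc n) \<omega>)) =
    ?E (\<lambda>\<omega>. (\<Sum>k\<in>{1..n}. P 1 k \<omega> * u k \<omega> * g1 k \<omega> * r1 k \<omega> + P (- 1) k \<omega> * u k \<omega> * g1 k \<omega> * r0 k \<omega>) +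
      \<Psi> \<omega> * f (\<xi> (Suc n) \<omega>) * g0 0 \<omega>)"
  proof (rule integral_cong_AE)
    show "AE \<omega> in M. \<Psi> \<omega> * f (Y (Suc n) \<omega>) = (\<Sum>k\<in>{1..n}. P 1 k \<omega> * u k \<omega> * g1 k \<omega> * r1 k \<omega> + P (- 1) k \<omega> * u k \<omega> * g1 k \<omega> * r0 k \<omega>) +
      \<Psi> \<omega> * f (\<xi> (Suc n) \<omega>) * g0 0 \<omega>"
      using AE_inputs_in_range
    proof eventually_elim
      case (elim \<omega>)
      then have U: "U n \<omega> \<in> {1..n}" using n by auto
      have "(\<Sum>k\<in>{1..n}. P 1 k \<omega> * u k \<omega> * g1 k \<omega> * r1 k \<omega> + P (- 1) k \<omega> * u k \<omega> * g1 k \<omega> * r0 k \<omega>) =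
        (\<Sum>k\<in>{1..n}. if k = U n \<omega> then P 1 k \<omega> * g1 k \<omega> * r1 k \<omega> + P (- 1) k \<omega> * g1 k \<omega> * r0 k \<omega> else 0)"
        by (rule sum.cong) (auto simp: d)
      also have "\<dots> = P 1 (U n \<omega>) \<omega> * g1 0 \<omega> * r1 0 \<omega> + P (- 1) (U n \<omega>) \<omega> * g1 0 \<omega> * r0 0 \<omega>"
        using U by (simp add: d)
      finally show ?case using Y_eq_select[OF n U refl] by (simp add: d P_def)
    qed
  qed (auto simp: d)
  also have "\<dots> = (\<Sum>k\<in>{1..n}. ?E (P 1 k) * (1 / n) * \<alpha> * p + ?E (P (- 1) k) * (1 / n) * \<alpha> * (1 - p)) +
      ?E \<Psi> * ?E (\<lambda>\<omega>. f (\<xi> 1 \<omega>)) * (1 - \<alpha>)"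
    using i1 i2 i3 t1 t2 t3 by (simp add: Bochner_Integration.integral_sum Bochner_Integration.integrable_sum)
  also have "\<dots> = \<alpha> / n * (\<Sum>k\<in>{1..n}. p * ?E (P 1 k) + (1 - p) * ?E (P (- 1) k)) + (1 - \<alpha>) * ?E \<Psi> * ?E (\<lambda>\<omega>. f (\<xi> 1 \<omega>))"
    by (simp add: sum_distrib_left distrib_left mult_ac)
  finally show ?thesis by (simp add: P_def[abs_def])
qed

lemma \<alpha>_nonneg: "0 \<le> \<alpha>"
  using law_gamma(1)[of 1] measure_nonneg by (metis order_refl)

lemma expectation_even_le:
  fixes f :: "real \<Rightarrow> real"
  assumes [measurable]: "f \<in> borel_measurable borel" and f: "\<And>x. \<bar>f x\<bar> \<le> B" "\<And>x. f (- x) = f x" "f 0 = 0"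
    and "n \<ge> 1"
  shows "expectation (\<lambda>\<omega>. f (Y n \<omega>)) \<le> expectation (\<lambda>\<omega>. f (\<xi> 1 \<omega>))"
  using \<open>n \<ge> 1\<close>
proof (induction n rule: less_induct)
  case (less n)
  show ?case
  proof (cases "n = 1")
    case True
    then show ?thesis by (simp add: Y.simps(2))
  next
    case False
    then obtain m where m: "n = Suc m" "m \<ge> 1" using less.prems by (cases n) auto
    let ?e = "expectation (\<lambda>\<omega>. f (\<xi> 1 \<omega>))"
    have "expectation (\<lambda>\<omega>. f (Y n \<omega>)) =
        \<alpha> / m * (\<Sum>k\<in>{1..m}. p * expectation (\<lambda>\<omega>. f (Y k \<omega>)) + (1 - p) * expectation (\<lambda>\<omega>. f (Y k \<omega>))) + (1 - \<alpha>) * ?e"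
      using expectation_next_step[OF m(2), of "\<lambda>_. 1" 1 f B] f m(1) by (simp add: prob_space)
    also have "\<dots> = \<alpha> / m * (\<Sum>k\<in>{1..m}. expectation (\<lambda>\<omega>. f (Y k \<omega>))) + (1 - \<alpha>) * ?e"
      by (simp add: algebra_simps)
    also have "\<dots> \<le> \<alpha> / m * (\<Sum>k\<in>{1..m}. ?e) + (1 - \<alpha>) * ?e"
      using \<alpha>_nonneg m less.IH by (intro add_right_mono mult_left_mono sum_mono) auto
    also have "\<dots> = ?e" using m by (simp add: algebra_simps)
    finally show ?thesis .
  qed
qed

definition drift :: "real \<Rightarrow> nat \<Rightarrow> 'w \<Rightarrow> real" where
  "drift b n \<omega> = (2 * p - 1) * \<alpha> / n * (\<Sum>k\<in>{1..n}. trunc b (Y k \<omega>)) + (1 - \<alpha>) * expectation (\<lambda>\<omega>. trunc b (\<xi> 1 \<omega>))"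

definition innovation :: "real \<Rightarrow> nat \<Rightarrow> 'w \<Rightarrow> real" where
  "innovation b n \<omega> = trunc b (Y (Suc n) \<omega>) - drift b n \<omega>"

lemma drift_adapted: "drift b n \<in> borel_measurable (F n)"
  unfolding drift_def[abs_def]
  by (intro borel_measurable_add borel_measurable_times borel_measurable_sum borel_measurable_const
      measurable_compose[OF Y_adapted measurable_trunc]) auto

lemma innovation_adapted: "innovation b n \<in> borel_measurable (F (Suc n))"
  unfolding innovation_def[abs_def]
  by (intro borel_measurable_diff measurable_compose[OF Y_adapted measurable_trunc]
      measurable_F_mono[OF _ drift_adapted]) auto

lemma measurable_drift [measurable]: "drift b n \<in> borel_measurable M"
  by (rule measurable_F[OF drift_adapted])

lemma measurable_innovation [measurable]: "innovation b n \<in> borel_measurable M"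
  by (rule measurable_F[OF innovation_adapted])

lemma drift_bounded: "\<exists>C. \<forall>\<omega>. \<bar>drift b n \<omega>\<bar> \<le> C"
proof (intro exI allI)
  fix \<omega>
  let ?c = "(2 * p - 1) * \<alpha> / n" and ?e = "(1 - \<alpha>) * expectation (\<lambda>\<omega>. trunc b (\<xi> 1 \<omega>))"
  have "\<bar>\<Sum>k\<in>{1..n}. trunc b (Y k \<omega>)\<bar> \<le> (\<Sum>k\<in>{1..n}. \<bar>b\<bar>)"
    by (rule order_trans[OF sum_abs sum_mono]) (rule abs_trunc_le)
  then have "\<bar>?c\<bar> * \<bar>\<Sum>k\<in>{1..n}. trunc b (Y k \<omega>)\<bar> \<le> \<bar>?c\<bar> * (\<Sum>k\<in>{1..n}. \<bar>b\<bar>)"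
    by (rule mult_left_mono) simp
  moreover have "\<bar>drift b n \<omega>\<bar> \<le> \<bar>?c\<bar> * \<bar>\<Sum>k\<in>{1..n}. trunc b (Y k \<omega>)\<bar> + \<bar>?e\<bar>"
    unfolding drift_def abs_mult[symmetric] by (rule abs_triangle_ineq)
  ultimately show "\<bar>drift b n \<omega>\<bar> \<le> \<bar>?c\<bar> * (\<Sum>k\<in>{1..n}. \<bar>b\<bar>) + \<bar>?e\<bar>" by linarith
qed

lemma innovation_bounded: "\<exists>C. \<forall>\<omega>. \<bar>innovation b n \<omega>\<bar> \<le> C"
proof -
  from drift_bounded[of b n] obtain C where C: "\<And>\<omega>. \<bar>drift b n \<omega>\<bar> \<le> C" by blast
  have "\<bar>innovation b n \<omega>\<bar> \<le> \<bar>b\<bar> + C" for \<omega>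
    using C[of \<omega>] abs_trunc_le(1)[of b "Y (Suc n) \<omega>"] unfolding innovation_def by linarith
  then show ?thesis by blast
qed

lemma integrable_bounded:
  fixes f :: "'w \<Rightarrow> real"
  assumes "f \<in> borel_measurable M" "\<exists>C. \<forall>\<omega>. \<bar>f \<omega>\<bar> \<le> C"
  shows "integrable M f"
proof -
  from assms(2) obtain C where "\<And>\<omega>. \<bar>f \<omega>\<bar> \<le> C" by blast
  then show ?thesis using assms(1) by (intro integrable_const_bound[of f C]) auto
qed

lemma bounded_mult:
  fixes f g :: "'w \<Rightarrow> real"
  assumes "\<exists>C. \<forall>\<omega>. \<bar>f \<omega>\<bar> \<le> C" "\<exists>C. \<forall>\<omega>. \<bar>g \<omega>\<bar> \<le> C"
  shows "\<exists>C. \<forall>\<omega>. \<bar>f \<omega> * g \<omega>\<bar> \<le> C"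
proof -
  from assms obtain C C' where *: "\<And>\<omega>. \<bar>f \<omega>\<bar> \<le> C" "\<And>\<omega>. \<bar>g \<omega>\<bar> \<le> C'" by blast
  then have "0 \<le> C" using abs_ge_zero order_trans by blast
  with * have "\<bar>f \<omega> * g \<omega>\<bar> \<le> C * C'" for \<omega> unfolding abs_mult by (intro mult_mono) auto
  then show ?thesis by blast
qed

lemma trunc_bounded: "\<exists>C. \<forall>\<omega>. \<bar>trunc b (f \<omega>)\<bar> \<le> C"
  using abs_trunc_le(1) by blast

lemma innovation_orthogonal:
  fixes \<Psi> :: "'w \<Rightarrow> real"
  assumes n: "n \<ge> 1" and \<Psi>: "\<Psi> \<in> borel_measurable (F n)" and bdd: "\<exists>C. \<forall>\<omega>. \<bar>\<Psi> \<omega>\<bar> \<le> C"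
  shows "expectation (\<lambda>\<omega>. \<Psi> \<omega> * innovation b n \<omega>) = 0"
proof -
  let ?E = expectation
  note measurable_F[OF \<Psi>, measurable]
  from bdd obtain C where C: "\<And>\<omega>. \<bar>\<Psi> \<omega>\<bar> \<le> C" by blast
  have i: "integrable M (\<lambda>\<omega>. \<Psi> \<omega> * trunc b (Y k \<omega>))" for k
    by (intro integrable_bounded bounded_mult bdd trunc_bounded) simp
  have i\<Psi>: "integrable M \<Psi>" by (intro integrable_bounded bdd) simp
  have i2: "integrable M (\<lambda>\<omega>. \<Psi> \<omega> * drift b n \<omega>)"
    by (intro integrable_bounded bounded_mult bdd drift_bounded) simp
  have "?E (\<lambda>\<omega>. \<Psi> \<omega> * drift b n \<omega>) =
      ?E (\<lambda>\<omega>. (2 * p - 1) * \<alpha> / n * (\<Sum>k\<in>{1..n}. \<Psi> \<omega> * trunc b (Y k \<omega>)) + (1 - \<alpha>) * ?E (\<lambda>\<omega>. trunc b (\<xi> 1 \<omega>)) * \<Psi> \<omega>)"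
    unfolding drift_def by (intro Bochner_Integration.integral_cong refl) (simp add: sum_distrib_left distrib_left mult_ac)
  also have "\<dots> = (2 * p - 1) * \<alpha> / n * (\<Sum>k\<in>{1..n}. ?E (\<lambda>\<omega>. \<Psi> \<omega> * trunc b (Y k \<omega>))) + (1 - \<alpha>) * ?E (\<lambda>\<omega>. trunc b (\<xi> 1 \<omega>)) * ?E \<Psi>"
    using i i\<Psi> by (simp add: Bochner_Integration.integral_sum Bochner_Integration.integrable_sum)
  also have "\<dots> = ?E (\<lambda>\<omega>. \<Psi> \<omega> * trunc b (Y (Suc n) \<omega>))"
  proof -
    have eq: "p * x + - ((1 - p) * x) = (2 * p - 1) * x" for x :: real by (simp add: algebra_simps)
    show ?thesis
      using expectation_next_step[OF n \<Psi> C measurable_trunc abs_trunc_le(1) trunc_0, of b]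
      by (simp only: trunc_minus mult_minus_right Bochner_Integration.integral_minus eq sum_distrib_left[symmetric])
        (simp add: sum_distrib_left mult_ac)
  qed
  finally show ?thesis unfolding innovation_def right_diff_distrib using i i2 by simp
qed

lemma innovation_second_moment_le:
  assumes n: "n \<ge> 1"
  shows "expectation (\<lambda>\<omega>. (innovation b n \<omega>)\<^sup>2) \<le> expectation (\<lambda>\<omega>. (trunc b (\<xi> 1 \<omega>))\<^sup>2)"
proof -
  let ?D = "innovation b n" and ?H = "\<lambda>\<omega>. trunc b (Y (Suc n) \<omega>)"
  have int: "integrable M (\<lambda>\<omega>. (?D \<omega>)\<^sup>2)" "integrable M (\<lambda>\<omega>. (?H \<omega>)\<^sup>2)"
      "integrable M (\<lambda>\<omega>. ?D \<omega> * ?H \<omega>)" "integrable M (\<lambda>\<omega>. drift b n \<omega> * ?D \<omega>)"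
    unfolding power2_eq_square
    by (intro integrable_bounded bounded_mult innovation_bounded drift_bounded trunc_bounded; simp)+
  have "expectation (\<lambda>\<omega>. (?D \<omega>)\<^sup>2) = expectation (\<lambda>\<omega>. ?D \<omega> * ?H \<omega> - drift b n \<omega> * ?D \<omega>)"
    by (intro Bochner_Integration.integral_cong refl) (simp add: innovation_def power2_eq_square algebra_simps)
  also have "\<dots> = expectation (\<lambda>\<omega>. ?D \<omega> * ?H \<omega>)"
    using int innovation_orthogonal[OF n drift_adapted drift_bounded] by simp
  also have "\<dots> \<le> expectation (\<lambda>\<omega>. ((?D \<omega>)\<^sup>2 + (?H \<omega>)\<^sup>2) / 2)"
  proof (rule integral_mono)
    show "?D \<omega> * ?H \<omega> \<le> ((?D \<omega>)\<^sup>2 + (?H \<omega>)\<^sup>2) / 2" for \<omega>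
      using sum_squares_bound[of "?D \<omega>" "?H \<omega>"] by simp
  qed (use int in auto)
  also have "\<dots> = (expectation (\<lambda>\<omega>. (?D \<omega>)\<^sup>2) + expectation (\<lambda>\<omega>. (?H \<omega>)\<^sup>2)) / 2"
    using int by simp
  finally have "expectation (\<lambda>\<omega>. (?D \<omega>)\<^sup>2) \<le> expectation (\<lambda>\<omega>. (?H \<omega>)\<^sup>2)" by simp
  also have "\<dots> \<le> expectation (\<lambda>\<omega>. (trunc b (\<xi> 1 \<omega>))\<^sup>2)"
  proof (rule expectation_even_le[where f = "\<lambda>x. (trunc b x)\<^sup>2" and B = "\<bar>b\<bar>\<^sup>2"])
    show "\<bar>(trunc b x)\<^sup>2\<bar> \<le> \<bar>b\<bar>\<^sup>2" for x
      using power_mono[OF abs_trunc_le(1)[of b x], of 2] by simp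
  qed auto
  finally show ?thesis .
qed

lemma AE_summable_innovations:
  assumes "finite_moment M (\<xi> 1) r" and s: "1 / r \<le> s"
  shows "AE \<omega> in M. summable (\<lambda>n. innovation (real (n + 2) powr (1 / r)) (n + 1) \<omega> * real (n + 2) powr (- s))"
proof -
  interpret m: finite_moment M "\<xi> 1" r by fact
  define d where "d n \<omega> = innovation (real (n + 2) powr (1 / r)) (n + 1) \<omega> * real (n + 2) powr (- s)" for n \<omega>
  have d_adapted: "d n \<in> borel_measurable (F (n + 2))" for n
    unfolding d_def[abs_def] using innovation_adapted[of _ "n + 1"] by (intro borel_measurable_times) auto
  then have [measurable]: "d n \<in> borel_measurable M" for n using measurable_F by blast
  have d_bounded: "\<exists>C. \<forall>\<omega>. \<bar>d n \<omega>\<bar> \<le> C" for n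
    unfolding d_def by (intro bounded_mult innovation_bounded) auto
  interpret L: L2_martingale_differences M "\<lambda>n. F (n + 1)" d
  proof
    fix n
    show "subalgebra M (F (n + 1))" by (rule subalgebra_F)
    show "d n \<in> borel_measurable (F (Suc n + 1))" using d_adapted[of n] by simp
    show "integrable M (\<lambda>\<omega>. (d n \<omega>)\<^sup>2)"
      unfolding power2_eq_square by (intro integrable_bounded bounded_mult d_bounded) simp
    interpret G: finite_measure_subalgebra M "F (n + 1)" by unfold_locales (rule subalgebra_F)
    interpret G: sigma_finite_subalgebra M "F (n + 1)"
      by (rule finite_measure_subalgebra_is_sigma_finite) unfold_locales
    show "AE \<omega> in M. real_cond_exp M (F (n + 1)) (d n) \<omega> = 0"
    proof (rule G.real_cond_exp_charact)
      fix A assume A: "A \<in> sets (F (n + 1))"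
      have "expectation (\<lambda>\<omega>. indicator A \<omega> * innovation (real (n + 2) powr (1 / r)) (n + 1) \<omega>) = 0"
        by (rule innovation_orthogonal) (use A in \<open>auto intro!: exI[of _ 1] simp: indicator_def\<close>)
      then have "expectation (\<lambda>\<omega>. indicator A \<omega> * innovation (real (n + 2) powr (1 / r)) (n + 1) \<omega> * real (n + 2) powr (- s)) = 0"
        by (subst integral_mult_left_zero) simp
      then show "(\<integral>\<omega>\<in>A. d n \<omega> \<partial>M) = (\<integral>\<omega>\<in>A. 0 \<partial>M)"
        unfolding set_lebesgue_integral_def d_def real_scaleR_def mult.assoc by simp
    next
      show "integrable M (d n)" by (intro integrable_bounded d_bounded) simp
    qed auto
  next
    show "m \<le> n \<Longrightarrow> sets (F (m + 1)) \<subseteq> sets (F (n + 1))" for m n by (rule sets_F_mono) simp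
  qed
  have "summable (\<lambda>n. expectation (\<lambda>\<omega>. (d n \<omega>)\<^sup>2))"
  proof (rule summable_comparison_test'[where N = 0])
    show "summable (\<lambda>n. expectation (\<lambda>\<omega>. real (n + 1 + 1) powr (- 2 / r) * (trunc (real (n + 1 + 1) powr (1 / r)) (\<xi> 1 \<omega>))\<^sup>2))"
      using summable_ignore_initial_segment[OF m.summable_truncated_second_moments, of 1] .
    fix n
    let ?b = "real (n + 2) powr (1 / r)"
    have "expectation (\<lambda>\<omega>. (d n \<omega>)\<^sup>2) = (real (n + 2) powr (- s))\<^sup>2 * expectation (\<lambda>\<omega>. (innovation ?b (n + 1) \<omega>)\<^sup>2)"
      by (simp add: d_def power_mult_distrib)
    also have "\<dots> \<le> real (n + 2) powr (- 2 / r) * expectation (\<lambda>\<omega>. (trunc ?b (\<xi> 1 \<omega>))\<^sup>2)"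
    proof (rule mult_mono)
      have "(real (n + 2) powr (- s))\<^sup>2 = real (n + 2) powr (- 2 * s)"
        by (simp add: power2_eq_square powr_add[symmetric])
      also have "\<dots> \<le> real (n + 2) powr (- 2 / r)"
        using s by (intro powr_mono) (auto simp: field_simps)
      finally show "(real (n + 2) powr (- s))\<^sup>2 \<le> real (n + 2) powr (- 2 / r)" .
      show "expectation (\<lambda>\<omega>. (innovation ?b (n + 1) \<omega>)\<^sup>2) \<le> expectation (\<lambda>\<omega>. (trunc ?b (\<xi> 1 \<omega>))\<^sup>2)"
        by (rule innovation_second_moment_le) simp
    qed (auto intro: integral_nonneg_AE)
    finally show "norm (expectation (\<lambda>\<omega>. (d n \<omega>)\<^sup>2)) \<le>
        expectation (\<lambda>\<omega>. real (n + 1 + 1) powr (- 2 / r) * (trunc (real (n + 1 + 1) powr (1 / r)) (\<xi> 1 \<omega>))\<^sup>2)"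
      by (simp add: integral_nonneg_AE add_ac)
  qed
  then show ?thesis using L.AE_summable by (simp only: d_def)
qed

lemma AE_eventually_Y_le:
  assumes "finite_moment M (\<xi> 1) r"
  shows "AE \<omega> in M. \<forall>\<^sub>F n in sequentially. \<bar>Y n \<omega>\<bar> \<le> real n powr (1 / r)"
proof -
  interpret m: finite_moment M "\<xi> 1" r by fact
  define A where "A n = {\<omega> \<in> space M. \<bar>Y (n + 1) \<omega>\<bar> > real (n + 1) powr (1 / r)}" for n
  have [measurable]: "A n \<in> sets M" for n unfolding A_def by measurable
  have "summable (\<lambda>n. prob (A n))"
  proof (rule summable_comparison_test'[OF m.summable_tail_probabilities, where N = 0])
    fix n
    let ?f = "\<lambda>x::real. of_bool (\<bar>x\<bar> > real (n + 1) powr (1 / r)) :: real"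
    have "prob (A n) = expectation (indicator (A n))" by simp
    also have "\<dots> = expectation (\<lambda>\<omega>. ?f (Y (n + 1) \<omega>))"
      by (rule Bochner_Integration.integral_cong) (auto simp: A_def indicator_def)
    also have "\<dots> \<le> expectation (\<lambda>\<omega>. ?f (\<xi> 1 \<omega>))"
      by (rule expectation_even_le[where B = 1]) (auto simp: not_less)
    finally show "norm (prob (A n)) \<le> expectation (\<lambda>\<omega>. ?f (\<xi> 1 \<omega>))" by simp
  qed
  then have "AE \<omega> in M. \<forall>\<^sub>F n in sequentially. \<omega> \<in> space M - A n"
    by (intro borel_cantelli_AE1) (auto simp: emeasure_eq_measure)
  then show ?thesis
  proof eventually_elim
    case (elim \<omega>)
    then have "\<forall>\<^sub>F n in sequentially. \<bar>Y (Suc n) \<omega>\<bar> \<le> real (Suc n) powr (1 / r)"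
      by eventually_elim (auto simp: A_def not_less)
    then show ?case by (rule eventually_sequentially_Suc[THEN iffD1])
  qed
qed

theorem AE_walk_fluctuation:
  fixes a c :: real
  assumes "finite_moment M (\<xi> 1) r" and s: "1 / r \<le> s" "a < s"
    and a: "a = (2 * p - 1) * \<alpha>" and c: "c * (1 - a) = (1 - \<alpha>) * expectation (\<xi> 1)"
  shows "AE \<omega> in M. (\<lambda>n. ((\<Sum>k\<in>{1..n}. X k \<omega>) - c * n) * real n powr (- s)) \<longlonglongrightarrow> 0"
  using AE_summable_innovations[OF assms(1) s(1)] AE_eventually_Y_le[OF assms(1)] AE_X_eq_Y
proof eventually_elim
  case (elim \<omega>)
  interpret m: finite_moment M "\<xi> 1" r by fact
  have s0: "s > 0" using s(1) m.r by (smt (verit) divide_pos_pos)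
  define b where "b n = real n powr (1 / r)" for n
  define mt where "mt n = expectation (\<lambda>\<omega>. trunc (b n) (\<xi> 1 \<omega>))" for n
  define W where "W n = (\<Sum>k\<in>{1..n}. Y k \<omega>) - c * n" for n
  define tail where "tail n = (\<Sum>k\<in>{1..n}. Y k \<omega> - trunc (b (Suc n)) (Y k \<omega>))" for n
  define \<delta> where "\<delta> n = innovation (b n) (n - 1) \<omega>" for n
  define \<beta> where "\<beta> n = (Y n \<omega> - trunc (b n) (Y n \<omega>)) - a / real (n - 1) * tail (n - 1) - (1 - \<alpha>) * (expectation (\<xi> 1) - mt n)" for n
  from elim(2) obtain N where N: "\<And>n. n \<ge> N \<Longrightarrow> \<bar>Y n \<omega>\<bar> \<le> b n"
    unfolding eventually_sequentially b_def by blast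
  have b_mono: "b m \<le> b n" if "m \<le> n" for m n
    unfolding b_def using that m.r by (intro powr_mono2) auto
  have "(\<lambda>n. W n * real n powr (- s)) \<longlonglongrightarrow> 0"
  proof (rule perturbed_growth_recursion_tendsto_0[where a = a and \<delta> = \<delta> and \<beta> = \<beta>])
    fix n :: nat assume n: "n \<ge> 1"
    have sum: "(\<Sum>k\<in>{1..Suc n}. Y k \<omega>) = (\<Sum>k\<in>{1..n}. Y k \<omega>) + Y (Suc n) \<omega>" by simp
    have tail: "tail n = (\<Sum>k\<in>{1..n}. Y k \<omega>) - (\<Sum>k\<in>{1..n}. trunc (b (Suc n)) (Y k \<omega>))"
      by (simp add: tail_def sum_subtractf)
    define x where "x = a / real n"
    let ?S = "\<Sum>k\<in>{1..n}. Y k \<omega>" and ?H = "\<Sum>k\<in>{1..n}. trunc (b (Suc n)) (Y k \<omega>)"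
    have "\<beta> (Suc n) = (Y (Suc n) \<omega> - trunc (b (Suc n)) (Y (Suc n) \<omega>)) - x * tail n - (1 - \<alpha>) * (expectation (\<xi> 1) - mt (Suc n))"
      by (simp add: \<beta>_def x_def)
    moreover have "\<delta> (Suc n) = trunc (b (Suc n)) (Y (Suc n) \<omega>) - (x * ?H + (1 - \<alpha>) * mt (Suc n))"
      by (simp add: \<delta>_def innovation_def drift_def mt_def x_def a)
    moreover have "x * tail n = x * ?S - x * ?H" unfolding tail by (rule right_diff_distrib)
    moreover have "(1 - \<alpha>) * (expectation (\<xi> 1) - mt (Suc n)) = (1 - \<alpha>) * expectation (\<xi> 1) - (1 - \<alpha>) * mt (Suc n)"
      by (rule right_diff_distrib)
    moreover have "c - c * a = (1 - \<alpha>) * expectation (\<xi> 1)" unfolding c[symmetric] by (simp add: right_diff_distrib)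
    moreover have "W n * (1 + x) = W n + x * ?S - c * a"
    proof -
      have "c * real n * x = c * a" using n by (simp add: x_def)
      then show ?thesis by (simp add: W_def distrib_left left_diff_distrib mult.commute[of x])
    qed
    moreover have "W (Suc n) = W n + Y (Suc n) \<omega> - c" by (simp add: W_def distrib_left)
    ultimately show "W (Suc n) = W n * (1 + a / real n) + \<delta> (Suc n) + \<beta> (Suc n)"
      unfolding x_def[symmetric] by linarith
  next
    show "summable (\<lambda>n. \<delta> (n + 2) * real (n + 2) powr - s)"
      using elim(1) by (simp add: \<delta>_def b_def)
  next
    have small: "(\<lambda>n. real (Suc n) powr (1 - s) * (Y (Suc n) \<omega> - trunc (b (Suc n)) (Y (Suc n) \<omega>))) \<longlonglongrightarrow> 0"
    proof (rule tendsto_eventually)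
      show "\<forall>\<^sub>F n in sequentially. real (Suc n) powr (1 - s) * (Y (Suc n) \<omega> - trunc (b (Suc n)) (Y (Suc n) \<omega>)) = 0"
        unfolding eventually_sequentially using N by (intro exI[of _ N]) (auto simp: trunc_def)
    qed
    define C where "C = (\<Sum>k\<in>{..<N}. \<bar>Y k \<omega>\<bar>)"
    have tail_le: "\<bar>tail n\<bar> \<le> C" for n
    proof -
      have "\<bar>tail n\<bar> \<le> (\<Sum>k\<in>{1..n}. \<bar>Y k \<omega> - trunc (b (Suc n)) (Y k \<omega>)\<bar>)"
        unfolding tail_def by (rule sum_abs)
      also have "\<dots> \<le> (\<Sum>k\<in>{1..n}. if k < N then \<bar>Y k \<omega>\<bar> else 0)"
      proof (rule sum_mono)
        fix k assume k: "k \<in> {1..n}"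
        show "\<bar>Y k \<omega> - trunc (b (Suc n)) (Y k \<omega>)\<bar> \<le> (if k < N then \<bar>Y k \<omega>\<bar> else 0)"
          using N[of k] b_mono[of k "Suc n"] k by (auto simp: trunc_def)
      qed
      also have "\<dots> = (\<Sum>k\<in>{1..n} \<inter> {..<N}. \<bar>Y k \<omega>\<bar>)" by (simp add: sum.inter_restrict)
      also have "\<dots> \<le> C" unfolding C_def by (intro sum_mono2) auto
      finally show ?thesis .
    qed
    have mid: "(\<lambda>n. real (Suc n) powr (1 - s) * (a / real n * tail n)) \<longlonglongrightarrow> 0"
    proof (rule Lim_null_comparison)
      show "\<forall>\<^sub>F n in sequentially. norm (real (Suc n) powr (1 - s) * (a / real n * tail n)) \<le>
          \<bar>a\<bar> * C * (real (Suc n) powr (1 - s) / real n)"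
      proof (intro always_eventually allI)
        fix n
        have "norm (real (Suc n) powr (1 - s) * (a / real n * tail n)) = \<bar>a\<bar> * (real (Suc n) powr (1 - s) / real n) * \<bar>tail n\<bar>"
          by (simp add: abs_mult)
        also have "\<dots> \<le> \<bar>a\<bar> * (real (Suc n) powr (1 - s) / real n) * C"
          using tail_le by (intro mult_left_mono) auto
        finally show "norm (real (Suc n) powr (1 - s) * (a / real n * tail n)) \<le> \<bar>a\<bar> * C * (real (Suc n) powr (1 - s) / real n)"
          by (simp add: mult_ac)
      qed
      have "(\<lambda>n. real (Suc n) powr (1 - s) / real n) \<longlonglongrightarrow> 0" using s0 by real_asymp
      from tendsto_mult_left[OF this, of "\<bar>a\<bar> * C"]
      show "(\<lambda>n. \<bar>a\<bar> * C * (real (Suc n) powr (1 - s) / real n)) \<longlonglongrightarrow> 0" by simp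
    qed
    have last: "(\<lambda>n. real (Suc n) powr (1 - s) * (expectation (\<xi> 1) - mt (Suc n))) \<longlonglongrightarrow> 0"
    proof (rule Lim_null_comparison)
      let ?g = "\<lambda>n. real n powr (1 - 1 / r) * (expectation (\<xi> 1) - mt n)"
      have "(\<lambda>n. \<bar>?g n\<bar>) \<longlonglongrightarrow> 0"
        using tendsto_rabs_zero[OF m.truncated_mean_rate] by (simp add: mt_def b_def)
      then show "(\<lambda>n. \<bar>?g (Suc n)\<bar>) \<longlonglongrightarrow> 0" by (rule LIMSEQ_Suc)
      show "\<forall>\<^sub>F n in sequentially. norm (real (Suc n) powr (1 - s) * (expectation (\<xi> 1) - mt (Suc n))) \<le> \<bar>?g (Suc n)\<bar>"
        unfolding real_norm_def abs_mult using s(1)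
        by (intro always_eventually allI mult_right_mono) (auto intro!: powr_mono)
    qed
    have "(\<lambda>n. real (Suc n) powr (1 - s) * \<beta> (Suc n)) \<longlonglongrightarrow> 0 - 0 - (1 - \<alpha>) * 0"
    proof (rule Lim_transform_eventually[OF tendsto_diff[OF tendsto_diff[OF small mid] tendsto_mult_left[OF last]]])
      show "\<forall>\<^sub>F n in sequentially.
        real (Suc n) powr (1 - s) * (Y (Suc n) \<omega> - trunc (b (Suc n)) (Y (Suc n) \<omega>)) -
        real (Suc n) powr (1 - s) * (a / real n * tail n) -
        (1 - \<alpha>) * (real (Suc n) powr (1 - s) * (expectation (\<xi> 1) - mt (Suc n))) =
        real (Suc n) powr (1 - s) * \<beta> (Suc n)"
        by (intro always_eventually allI) (simp add: \<beta>_def right_diff_distrib mult_ac)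
    qed
    then have "(\<lambda>n. real (Suc n) powr (1 - s) * \<beta> (Suc n)) \<longlonglongrightarrow> 0" by (simp only: diff_self mult_zero_right)
    then show "(\<lambda>n. real n powr (1 - s) * \<beta> n) \<longlonglongrightarrow> 0" by (rule filterlim_sequentially_Suc[THEN iffD1])
  qed (rule s(2))
  moreover have "(\<Sum>k\<in>{1..n}. X k \<omega>) = (\<Sum>k\<in>{1..n}. Y k \<omega>)" for n
    using elim(3) by (intro sum.cong) auto
  ultimately show ?case by (simp add: W_def)
qed

end

theorem theorem2:
  fixes M :: "'w measure"
    and \<xi> \<gamma> \<rho> X T :: "nat \<Rightarrow> 'w \<Rightarrow> real"
    and U :: "nat \<Rightarrow> 'w \<Rightarrow> nat"
    and p \<alpha> a r \<mu>1 :: real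
  assumes "step_reinforced_walk M \<xi> U \<gamma> \<rho> p \<alpha> X"
    and "0 \<le> p" "p \<le> 1" "0 < \<alpha>" "\<alpha> \<le> 1"
    and "\<And>n \<omega>. T n \<omega> = (\<Sum>k=1..n. X k \<omega>)"
    and "a = (2 * p - 1) * \<alpha>"
    and "1 < r" "r < 2"
    and "integrable M (\<lambda>\<omega>. \<bar>\<xi> 1 \<omega>\<bar> powr r)"
    and "\<mu>1 = prob_space.expectation M (\<xi> 1)"
  shows "(- 1 \<le> a \<and> a < 1 / 2 \<longrightarrow>
      (AE \<omega> in M. (\<lambda>n. real n powr (1 - 1 / r) * (T n \<omega> / real n - (1 - \<alpha>) * \<mu>1 / (1 - a)))
        \<longlonglongrightarrow> 0)) \<and>
    (a = 1 / 2 \<longrightarrow>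
      (AE \<omega> in M. (\<lambda>n. real n powr (1 - 1 / r) / sqrt (ln (real n)) *
          (T n \<omega> / real n - 2 * (1 - \<alpha>) * \<mu>1)) \<longlonglongrightarrow> 0)) \<and>
    (1 / 2 < a \<and> a < 1 \<longrightarrow>
      (AE \<omega> in M. (\<lambda>n. real n powr (3 / 2 - 1 / r - a) *
          (T n \<omega> / real n - (1 - \<alpha>) * \<mu>1 / (1 - a))) \<longlonglongrightarrow> 0))"
proof -
  interpret step_reinforced_walk M \<xi> U \<gamma> \<rho> p \<alpha> X by (rule assms(1))
  have fm: "finite_moment M (\<xi> 1) r"
    by unfold_locales (use assms measurable_inputs(1)[of 1] in auto)
  define c where "c = (1 - \<alpha>) * \<mu>1 / (1 - a)"
  have key: "AE \<omega> in M. (\<lambda>n. (T n \<omega> - c * n) * real n powr (- s)) \<longlonglongrightarrow> 0"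
    if "1 / r \<le> s" "a < s" "a < 1" for s
    unfolding assms(6) using that assms(11) by (intro AE_walk_fluctuation[OF fm _ _ assms(7)]) (auto simp: c_def)
  have half: "1 / 2 < 1 / r" using assms(8,9) by (simp add: field_simps)
  have scale: "real n powr (1 - s) * (T n \<omega> / n - c) = (T n \<omega> - c * n) * real n powr (- s)" for n \<omega> s
  proof (cases "n = 0")
    case False
    then have "real n powr (1 - s) = real n * real n powr (- s)"
      by (simp add: powr_diff powr_minus divide_inverse)
    then show ?thesis using False by (simp add: right_diff_distrib left_diff_distrib)
  qed simp
  show ?thesis
  proof (intro conjI impI)
    assume a: "- 1 \<le> a \<and> a < 1 / 2"
    show "AE \<omega> in M. (\<lambda>n. real n powr (1 - 1 / r) * (T n \<omega> / real n - (1 - \<alpha>) * \<mu>1 / (1 - a))) \<longlonglongrightarrow> 0"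
      using key[of "1 / r"] a half unfolding c_def[symmetric] scale by simp
  next
    assume a: "a = 1 / 2"
    have c: "c = 2 * (1 - \<alpha>) * \<mu>1" by (simp add: c_def a)
    have "AE \<omega> in M. (\<lambda>n. (T n \<omega> - c * n) * real n powr (- (1 / r))) \<longlonglongrightarrow> 0"
      using key[of "1 / r"] a half by simp
    then show "AE \<omega> in M. (\<lambda>n. real n powr (1 - 1 / r) / sqrt (ln (real n)) *
        (T n \<omega> / real n - 2 * (1 - \<alpha>) * \<mu>1)) \<longlonglongrightarrow> 0"
    proof eventually_elim
      case (elim \<omega>)
      have "(\<lambda>n. 1 / sqrt (ln (real n))) \<longlonglongrightarrow> 0" by real_asymp
      from tendsto_mult_zero[OF this elim] show ?case
        unfolding c[symmetric] scale[symmetric] by simp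
    qed
  next
    assume a: "1 / 2 < a \<and> a < 1"
    have s: "3 / 2 - 1 / r - a = 1 - (a + 1 / r - 1 / 2)" by simp
    show "AE \<omega> in M. (\<lambda>n. real n powr (3 / 2 - 1 / r - a) * (T n \<omega> / real n - (1 - \<alpha>) * \<mu>1 / (1 - a))) \<longlonglongrightarrow> 0"
      using key[of "a + 1 / r - 1 / 2"] a half unfolding c_def[symmetric] s scale by simp
  qed
qed

end
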